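(* Let $c>1$ be a positive integer and let $f>c$ be an integer with $\gcd(f,c)=1$. Define \[ M_{+}(f,c):=\sum_{\substack{\chi \bmod f,\ \chi(-1)=1\\ \chi\neq\chi_0}}\chi(c)\,|L(1,\chi)|^{2}, \] the sum over all non-trivial even Dirichlet characters modulo $f$. For a positive integer $d$ define \[ R(c,d):=\sum_{k=1}^{d-1}\log\bigl|2\sin(\pi k/d)\bigr|\,\log\bigl|2\sin(\pi ck/d)\bigr|. \] Then \[ M_{+}(f,c)=\frac{\phi(f)}{f^{2}}\sum_{d\mid f}\mu\!\left(\frac{f}{d}\right)d\left(\Bigl(\log\frac{f}{d}\Bigr)^{2}+R(c,d)\right)-\left(\frac{\phi(f)}{f}\sum_{p\mid f}\frac{\log p}{p-1}\right)^{2}. \]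
   Context: $\chi_0$ is the trivial character modulo $f$; $\phi$ is Euler's totient function; $\mu$ is the Möbius function; the sum over $p\mid f$ runs over the distinct primes dividing $f$; the sum over $d\mid f$ runs over positive divisors of $f$. *)

theory Defs
  imports
    "HOL-Analysis.Analysis"
    "HOL-Number_Theory.Number_Theory"
    "HOL-Computational_Algebra.Squarefree"
begin

definition moebius_mu :: "nat \<Rightarrow> int" where
  "moebius_mu n = (if squarefree n then (- 1) ^ card (prime_factors n) else 0)"

text \<open>Dirichlet characters are functions on all integers, extended by zero to the integers
  not coprime to the modulus.\<close>

definition dirichlet_character :: "nat \<Rightarrow> (int \<Rightarrow> complex) \<Rightarrow> bool" where
  "dirichlet_character f chi \<longleftrightarrow>
     (\<forall>m n. chi (m * n) = chi m * chi n) \<and>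
     (\<forall>n. chi (n + int f) = chi n) \<and>
     (\<forall>n. chi n \<noteq> 0 \<longleftrightarrow> coprime n (int f))"

definition trivial_character :: "nat \<Rightarrow> int \<Rightarrow> complex" where
  "trivial_character f n = (if coprime n (int f) then 1 else 0)"

text \<open>The Dirichlet series \<open>L(s, chi)\<close>, summed in the usual order over \<open>n \<ge> 1\<close>. For a non-trivial
  character it converges (conditionally at \<open>s = 1\<close>) for \<open>Re s > 0\<close>, so there is no need for
  analytic continuation. It is not meaningful at \<open>s = 1\<close> for the trivial character.\<close>

definition dirichlet_L :: "complex \<Rightarrow> (int \<Rightarrow> complex) \<Rightarrow> complex" where
  "dirichlet_L s chi = (\<Sum>n. chi (int (Suc n)) / of_nat (Suc n) powr s)"

definition M_plus :: "nat \<Rightarrow> nat \<Rightarrow> complex" where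
  "M_plus f c =
     (\<Sum>chi | dirichlet_character f chi \<and> chi (- 1) = 1 \<and> chi \<noteq> trivial_character f.
        chi (int c) * complex_of_real ((cmod (dirichlet_L 1 chi))\<^sup>2))"

definition R_sum :: "nat \<Rightarrow> nat \<Rightarrow> real" where
  "R_sum c d =
     (\<Sum>k = 1..<d. ln \<bar>2 * sin (pi * real k / real d)\<bar> *
                   ln \<bar>2 * sin (pi * real c * real k / real d)\<bar>)"

text \<open>The sum in \<open>M_plus\<close> ranges over a finite set, so it is not zero by convention.\<close>

lemma finite_dirichlet_characters:
  assumes "f > 0"
  shows "finite {chi. dirichlet_character f chi}"
proof -
  let ?A = "{0..<int f}"
  let ?B = "insert 0 {z :: complex. z ^ totient f = 1}"
  have periodic: "chi n = chi (n mod int f)" if "dirichlet_character f chi" for chi n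
  proof -
    have step: "chi (m + int f) = chi m" for m
      using that by (simp add: dirichlet_character_def)
    have nat_mult: "chi (m + int k * int f) = chi m" for m k
    proof (induction k)
      case (Suc k)
      have "chi (m + int (Suc k) * int f) = chi ((m + int k * int f) + int f)"
        by (simp add: algebra_simps)
      then show ?case using step Suc by simp
    qed simp
    have int_mult: "chi (m + q * int f) = chi m" for m q
    proof (cases "q \<ge> 0")
      case True
      then show ?thesis using nat_mult[of m "nat q"] by simp
    next
      case False
      then show ?thesis using nat_mult[of "m + q * int f" "nat (- q)"] by simp
    qed
    show ?thesis
      using int_mult[of "n mod int f" "n div int f"] by (simp add: mod_mult_div_eq ac_simps)
  qed
  have val: "chi n \<in> ?B" if "dirichlet_character f chi" for chi n
  proof (cases "coprime n (int f)")
    case False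
    then show ?thesis using that by (auto simp: dirichlet_character_def)
  next
    case True
    have mult: "chi (a * b) = chi a * chi b" for a b
      using that by (simp add: dirichlet_character_def)
    have "chi 1 \<noteq> 0" using that by (simp add: dirichlet_character_def)
    then have one: "chi 1 = 1" using mult[of 1 1] by simp
    have pow: "chi (n ^ k) = chi n ^ k" for k
      by (induction k) (simp_all add: one mult)
    define m where "m = nat (n mod int f)"
    have m: "int m = n mod int f" using assms by (simp add: m_def)
    have "coprime (int m) (int f)"
      using True assms by (simp add: m coprime_mod_left_iff)
    then have "[m ^ totient f = 1] (mod f)"
      by (intro euler_theorem) simp
    then have "[int m ^ totient f = 1] (mod int f)"
      using cong_int_iff[of "m ^ totient f" 1 f] by simp
    moreover have "[int m ^ totient f = n ^ totient f] (mod int f)"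
      by (intro cong_pow) (simp add: m)
    ultimately have "[n ^ totient f = 1] (mod int f)"
      using cong_sym cong_trans by blast
    then have "chi (n ^ totient f) = chi 1"
      using periodic[OF that, of "n ^ totient f"] periodic[OF that, of 1] by (simp add: cong_def)
    then show ?thesis by (simp add: pow one)
  qed
  have "finite ?B"
    using assms by (auto intro!: finite_roots_unity simp: Suc_le_eq)
  then have "finite (PiE ?A (\<lambda>_. ?B))" by (intro finite_PiE) auto
  moreover have "(\<lambda>chi. restrict chi ?A) ` {chi. dirichlet_character f chi} \<subseteq> PiE ?A (\<lambda>_. ?B)"
    using val by (intro image_subsetI) (auto simp: restrict_PiE_iff)
  moreover have "inj_on (\<lambda>chi. restrict chi ?A) {chi. dirichlet_character f chi}"
  proof (rule inj_onI, rule ext)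
    fix chi \<psi> :: "int \<Rightarrow> complex" and n
    assume "chi \<in> {chi. dirichlet_character f chi}" "\<psi> \<in> {chi. dirichlet_character f chi}"
      and eq: "restrict chi ?A = restrict \<psi> ?A"
    moreover have "chi (n mod int f) = \<psi> (n mod int f)"
      using fun_cong[OF eq, of "n mod int f"] assms by simp
    ultimately show "chi n = \<psi> n"
      using periodic[of chi n] periodic[of \<psi> n] by simp
  qed
  ultimately show ?thesis by (meson finite_subset finite_imageD)
qed

end

theory Submission
  imports Defs
begin

text \<open>Expanding an even non-trivial character \<open>chi\<close> in additive characters and summing
  \<open>\<Sum> z\<^sup>n / n = - Ln (1 - z)\<close> on the unit circle gives
  \<open>L(1, chi) = - 1/f \<Sum>\<^sub>k \<Sum>\<^sub>a chi(a) e(- a k / f) log |2 sin (\<pi> k / f)|\<close>. The right-hand side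
  vanishes for odd characters, and for the trivial one it is the quantity whose square is subtracted
  in the theorem. Summing over all characters, orthogonality leaves Ramanujan sums
  \<open>\<Sum>\<^bsub>d | f, d | c l - k\<^esub> \<mu>(f/d) d\<close>, and the sums of \<open>log |2 sin (\<pi> k / f)|\<close> over residue
  classes modulo \<open>d\<close> are evaluated by \<open>\<Prod>\<^sub>j |1 - \<omega>\<^sup>j w| = |1 - w\<^sup>m|\<close> with \<open>m = f/d\<close> and
  \<open>\<omega>\<close> a primitive \<open>m\<close>-th root of unity.\<close>

section \<open>Additive characters and roots of unity\<close>

text \<open>Characters modulo f may be imprimitive, so the Fourier coefficients of
  \<open>chi\<close> are never factored through a Gauss sum; they stay whole until orthogonality
  removes \<open>chi\<close>. The log-sine expression is defined for every character, its singular
  term k = 0 being dropped by \<open>ln 0 = 0\<close>; this gives access to the full character group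
  although the series diverges for the trivial character. Both terms of the main sum have one
  source: over a residue class r modulo d the log-sines modulo f add up to log |2 sin (pi r / d)|
  for r nonzero and to log (f / d) for r = 0. Pairing class r with class c r gives R(c, d) from the
  nonzero classes and the squared logarithm from the zero class. In the subtracted square the zero
  classes alone give the sum of mu(d) log d / d over d | f, up to sign the derivative at s = 1 of
  the product of 1 - p^(-s) over p | f; hence log p / (p - 1). The main cost is orthogonality: it
  needs a character separating a given unit from 1, built here by spectral projection and not by
  splitting the unit group into cyclic factors.\<close>

definition add_char :: "nat \<Rightarrow> int \<Rightarrow> complex" where
  "add_char f n = cis (2 * pi * of_int n / of_nat f)"

lemma add_char_0 [simp]: "add_char f 0 = 1"
  by (simp add: add_char_def)

lemma add_char_add: "add_char f (m + n) = add_char f m * add_char f n"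
  by (simp add: add_char_def cis_mult add_divide_distrib distrib_left)

lemma add_char_minus: "add_char f (- n) = cnj (add_char f n)"
  by (simp add: add_char_def cis_cnj)

lemma norm_add_char [simp]: "norm (add_char f n) = 1"
  by (simp add: add_char_def)

lemma add_char_nonzero [simp]: "add_char f n \<noteq> 0"
  by (simp add: add_char_def)

lemma add_char_power: "add_char f n ^ k = add_char f (int k * n)"
  by (simp add: add_char_def Complex.DeMoivre mult_ac)

lemma add_char_self [simp]: "f > 0 \<Longrightarrow> add_char f (int f * n) = 1"
  using cis_multiple_2pi[of "of_int n"] by (simp add: add_char_def mult_ac)

lemma add_char_eq_1_iff:
  assumes "f > 0"
  shows "add_char f n = 1 \<longleftrightarrow> int f dvd n"
proof
  assume "add_char f n = 1"
  then obtain k :: int where "2 * pi * of_int n / of_nat f = of_int k * (2 * pi)"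
    by (auto simp: add_char_def complex_eq_iff cos_one_2pi_int)
  then have "real_of_int n = real_of_int (int f * k)"
    using assms by (simp add: field_simps)
  then show "int f dvd n"
    by (simp only: of_int_eq_iff) simp
qed (use assms in auto)

lemma add_char_cong:
  assumes "f > 0" "[m = n] (mod int f)"
  shows "add_char f m = add_char f n"
proof -
  obtain k where "m = n + int f * k"
    using assms(2) by (metis cong_iff_lin cong_sym)
  then show ?thesis
    using assms(1) by (simp add: add_char_add)
qed

lemma add_char_mult_left:
  assumes "f > 0" "m > 0"
  shows "add_char (m * f) (int m * n) = add_char f n"
  using assms by (simp add: add_char_def field_simps)

lemma sum_add_char:
  assumes "f > 0"
  shows "(\<Sum>a\<in>{0..<int f}. add_char f (a * n)) = (if int f dvd n then of_nat f else 0)"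
proof -
  have "(\<Sum>a\<in>{0..<int f}. add_char f (a * n)) = (\<Sum>k<f. add_char f n ^ k)"
    by (rule sum.reindex_bij_witness[of _ int nat]) (auto simp: add_char_power)
  also have "\<dots> = (if int f dvd n then of_nat f else 0)"
  proof (cases "int f dvd n")
    case True
    then have "add_char f n = 1" using assms by (simp add: add_char_eq_1_iff)
    with True show ?thesis by simp
  next
    case False
    then have "(\<Sum>k<f. add_char f n ^ k) = 0"
      using assms by (simp only: sum_gp_strict) (simp add: add_char_eq_1_iff add_char_power)
    with False show ?thesis by simp
  qed
  finally show ?thesis .
qed

section \<open>Products over the m-th roots of unity\<close>

lemma roots_of_unity_eq_add_char:
  assumes "m > 0"
  shows "bij_betw (add_char m) {0..<int m} {z. z ^ m = 1}"
proof -
  have "inj_on (add_char m) {0..<int m}"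
  proof (rule inj_onI)
    fix x y assume xy: "x \<in> {0..<int m}" "y \<in> {0..<int m}" "add_char m x = add_char m y"
    have "add_char m (x - y) = 1"
      using xy(3) add_char_add[of m "x - y" y] by simp
    then have "[x = y] (mod int m)"
      using assms by (simp add: add_char_eq_1_iff cong_iff_dvd_diff)
    then show "x = y"
      using xy(1,2) by (simp add: cong_def)
  qed
  moreover from this have "card (add_char m ` {0..<int m}) = m"
    by (simp add: card_image)
  moreover have "add_char m ` {0..<int m} \<subseteq> {z. z ^ m = 1}"
    using assms by (auto simp: add_char_power)
  ultimately show ?thesis
    using assms card_roots_unity_eq[of m] finite_roots_unity[of m, where ?'a = complex]
      card_subset_eq[of "{z::complex. z ^ m = 1}" "add_char m ` {0..<int m}"]
    by (simp add: bij_betw_def)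
qed

text \<open>Both sides are polynomials in w of degree at most m, and they agree at m + 1 points: at
  0, and at each m-th root of unity z, where the factor with u = 1 / z vanishes.\<close>

lemma prod_roots_of_unity:
  fixes w :: complex
  assumes "m > 0"
  shows "(\<Prod>u | u ^ m = 1. 1 - u * w) = 1 - w ^ m"
proof -
  let ?U = "{u::complex. u ^ m = 1}"
  have fin: "finite ?U"
    using assms by (intro finite_roots_unity) auto
  have card: "card ?U = m"
    using assms by (simp add: card_roots_unity_eq)
  have card_insert: "card (insert 0 ?U) = Suc m"
    using fin card assms by (simp add: power_0_left)
  have "(\<Prod>u\<in>?U. [:1, - u:]) = 1 - Polynomial.monom 1 m"
  proof (rule poly_eqI_degree[of "insert 0 ?U"])
    fix z assume z: "z \<in> insert 0 ?U"
    show "poly (\<Prod>u\<in>?U. [:1, - u:]) z = poly (1 - Polynomial.monom 1 m) z"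
    proof (cases "z = 0")
      case True
      then show ?thesis using assms by (simp add: poly_prod poly_monom)
    next
      case False
      with z have "inverse z \<in> ?U" "z ^ m = 1" by (auto simp: power_inverse)
      moreover from False have "1 - inverse z * z = 0" by simp
      ultimately show ?thesis
        using fin by (auto simp: poly_prod poly_monom intro!: prod_zero bexI[of _ "inverse z"] simp: mult.commute)
    qed
  next
    have "degree (\<Prod>u\<in>?U. [:1, - u:]) \<le> (\<Sum>u\<in>?U. degree [:1, - u:])"
      using degree_prod_sum_le[OF fin, of "\<lambda>u. [:1, - u:]"] by (simp only: o_def)
    also have "\<dots> \<le> (\<Sum>u\<in>?U. 1)"
      by (intro sum_mono) simp
    finally show "degree (\<Prod>u\<in>?U. [:1, - u:]) < card (insert 0 ?U)"
      using card_insert card by simp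
    have "degree (1 - Polynomial.monom (1::complex) m) \<le> m"
      by (intro degree_diff_le) (auto simp: degree_monom_le)
    then show "degree (1 - Polynomial.monom (1::complex) m) < card (insert 0 ?U)"
      using card_insert card by simp
  qed
  then have "poly (\<Prod>u\<in>?U. [:1, - u:]) w = poly (1 - Polynomial.monom 1 m) w" by simp
  then show ?thesis by (simp add: poly_prod poly_monom mult.commute)
qed

text \<open>Dividing the full product by its factor 1 - w leaves the geometric sum 1 + w + ... +
  w^(m-1) for w \<noteq> 1; letting w tend to 1 gives m.\<close>

lemma prod_nontrivial_roots_of_unity:
  assumes "m > 0"
  shows "(\<Prod>u\<in>{u::complex. u ^ m = 1} - {1}. 1 - u) = of_nat m"
proof -
  let ?U = "{u::complex. u ^ m = 1}"
  have fin: "finite ?U"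
    using assms by (intro finite_roots_unity) auto
  have *: "(\<Prod>u\<in>?U - {1}. 1 - u * w) = (\<Sum>k<m. w ^ k)" if "w \<noteq> 1" for w
  proof -
    have "(1 - w) * (\<Prod>u\<in>?U - {1}. 1 - u * w) = 1 - w ^ m"
      using prod_roots_of_unity[OF assms, of w] prod.remove[OF fin, of 1 "\<lambda>u. 1 - u * w"] by simp
    also have "\<dots> = (1 - w) * (\<Sum>k<m. w ^ k)"
      by (rule one_diff_power_eq)
    finally show ?thesis using that by simp
  qed
  have "((\<lambda>w. \<Prod>u\<in>?U - {1}. 1 - u * w) \<longlongrightarrow> (\<Prod>u\<in>?U - {1}. 1 - u * 1)) (at 1)"
    by (intro tendsto_intros)
  moreover have "((\<lambda>w. \<Prod>u\<in>?U - {1}. 1 - u * w) \<longlongrightarrow> (\<Sum>k<m. 1 ^ k)) (at (1::complex))"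
  proof (rule Lim_transform_eventually)
    show "((\<lambda>w. \<Sum>k<m. w ^ k) \<longlongrightarrow> (\<Sum>k<m. 1 ^ k)) (at (1::complex))"
      by (intro tendsto_intros)
    show "\<forall>\<^sub>F w in at 1. (\<Sum>k<m. w ^ k) = (\<Prod>u\<in>?U - {1}. 1 - u * w)"
      using * by (auto simp: eventually_at intro!: exI[of _ 1])
  qed
  ultimately have "(\<Prod>u\<in>?U - {1}. 1 - u * 1) = (\<Sum>k<m. 1 ^ k)"
    by (intro tendsto_unique[OF at_neq_bot])
  then show ?thesis by simp
qed

section \<open>Logarithms of sines\<close>

definition log_sine :: "nat \<Rightarrow> int \<Rightarrow> real" where
  "log_sine d k = ln \<bar>2 * sin (pi * of_int k / of_nat d)\<bar>"

lemma norm_one_minus_cis: "cmod (1 - cis t) = \<bar>2 * sin (t / 2)\<bar>"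
proof (rule power2_eq_imp_eq)
  have "(cmod (1 - cis t))\<^sup>2 = (1 - cos t)\<^sup>2 + (sin t)\<^sup>2"
    by (simp add: cmod_power2)
  also have "\<dots> = 2 - 2 * cos (2 * (t / 2))"
    using sin_cos_squared_add[of t] by (simp add: power2_eq_square algebra_simps)
  also have "\<dots> = \<bar>2 * sin (t / 2)\<bar>\<^sup>2"
    by (simp only: cos_double_sin power2_abs) (simp add: power_mult_distrib)
  finally show "(cmod (1 - cis t))\<^sup>2 = \<bar>2 * sin (t / 2)\<bar>\<^sup>2" .
qed auto

text \<open>As distances from 1 to a root of unity, the sines become periodic in k and accessible to
  the product formulas above.\<close>

lemma log_sine_eq: "log_sine d k = ln (cmod (1 - add_char d k))"
  by (simp add: log_sine_def add_char_def norm_one_minus_cis field_simps)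

lemma log_sine_cong:
  "d > 0 \<Longrightarrow> [k = l] (mod int d) \<Longrightarrow> log_sine d k = log_sine d l"
  using add_char_cong[of d k l] by (simp add: log_sine_eq)

lemma log_sine_minus: "log_sine d (- k) = log_sine d k"
  by (simp add: log_sine_def)

text \<open>Rests on the convention \<open>ln 0 = 0\<close>, which lets sums over all residues replace sums over
  the nonzero ones.\<close>

lemma log_sine_dvd: "d > 0 \<Longrightarrow> int d dvd k \<Longrightarrow> log_sine d k = 0"
  by (simp add: log_sine_eq add_char_eq_1_iff[THEN iffD2])

text \<open>The terms are log |1 - u w| with u running over the m-th roots of unity and w^m = e(r /
  d). If w^m \<noteq> 1, the full product formula applies. Otherwise w is itself such a root, one
  factor is zero, and the product of the remaining factors is m.\<close>

lemma sum_log_sine_progression: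
  assumes "m > 0" "d > 0"
  shows "(\<Sum>j\<in>{0..<int m}. log_sine (m * d) (r + int d * j)) =
           log_sine d r + (if int d dvd r then ln (real m) else 0)"
proof -
  let ?U = "{u::complex. u ^ m = 1}"
  define w where "w = add_char (m * d) r"
  have fin: "finite ?U"
    using assms by (intro finite_roots_unity) auto
  have wm: "w ^ m = add_char d r"
    using assms by (simp add: w_def add_char_power add_char_mult_left)
  have "(\<Sum>j\<in>{0..<int m}. log_sine (m * d) (r + int d * j)) =
          (\<Sum>j\<in>{0..<int m}. ln (cmod (1 - add_char m j * w)))"
    using assms add_char_mult_left[of m d]
    by (intro sum.cong refl) (simp add: log_sine_eq add_char_add w_def mult.commute)
  also have "\<dots> = (\<Sum>u\<in>?U. ln (cmod (1 - u * w)))"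
    using sum.reindex_bij_betw[OF roots_of_unity_eq_add_char[OF assms(1)],
        of "\<lambda>u. ln (cmod (1 - u * w))"] by simp
  also have "\<dots> = log_sine d r + (if int d dvd r then ln (real m) else 0)"
  proof (cases "int d dvd r")
    case False
    then have "w ^ m \<noteq> 1"
      using assms by (simp add: wm add_char_eq_1_iff)
    then have nz: "1 - u * w \<noteq> 0" if "u \<in> ?U" for u
      using that power_mult_distrib[of u w m] by auto
    have "(\<Sum>u\<in>?U. ln (cmod (1 - u * w))) = ln (\<Prod>u\<in>?U. cmod (1 - u * w))"
      using fin nz by (subst ln_prod) auto
    also have "\<dots> = ln (cmod (1 - w ^ m))"
      using prod_roots_of_unity[OF assms(1), of w] by (simp add: prod_norm)
    finally show ?thesis using False by (simp add: wm log_sine_eq)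
  next
    case True
    then have w: "w ^ m = 1"
      using assms by (simp add: wm add_char_eq_1_iff)
    then have w0: "w \<noteq> 0" using assms by (auto simp: power_0_left)
    have "(\<Sum>u\<in>?U. ln (cmod (1 - u * w))) = (\<Sum>u\<in>?U. ln (cmod (1 - u)))"
      by (rule sum.reindex_bij_witness[of _ "\<lambda>u. u / w" "\<lambda>u. u * w"])
         (use w w0 in \<open>auto simp: power_mult_distrib power_divide\<close>)
    \<comment> \<open>The root u = 1 contributes \<open>ln 0 = 0\<close>.\<close>
    also have "\<dots> = (\<Sum>u\<in>?U - {1}. ln (cmod (1 - u)))"
      using fin by (subst sum.remove[of _ 1]) auto
    also have "\<dots> = ln (\<Prod>u\<in>?U - {1}. cmod (1 - u))"
      using fin by (subst ln_prod) auto
    also have "\<dots> = ln (real m)"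
      using prod_nontrivial_roots_of_unity[OF assms(1)] by (simp add: prod_norm)
    finally show ?thesis using True assms by (simp add: log_sine_dvd)
  qed
  finally show ?thesis .
qed

lemma bij_betw_progression:
  assumes "f = m * d" "d > 0" "m > 0"
  shows "bij_betw (\<lambda>j. n mod int d + int d * j) {0..<int m} {k\<in>{0..<int f}. [k = n] (mod int d)}"
proof (rule bij_betw_byWitness[of _ "\<lambda>k. k div int d"])
  show "(\<lambda>j. n mod int d + int d * j) ` {0..<int m} \<subseteq> {k\<in>{0..<int f}. [k = n] (mod int d)}"
  proof safe
    fix j assume j: "j \<in> {0..<int m}"
    have "n mod int d \<ge> 0" "n mod int d < int d" using assms by auto
    moreover have "int d * j \<le> int d * (int m - 1)" using j by (intro mult_left_mono) auto
    moreover have "int d * (int m - 1) = int f - int d" "int d * j \<ge> 0"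
      using assms j by (simp_all add: algebra_simps)
    ultimately show "n mod int d + int d * j \<in> {0..<int f}" by simp
    show "[n mod int d + int d * j = n] (mod int d)"
      by (simp add: cong_def)
  qed
  show "(\<lambda>k. k div int d) ` {k\<in>{0..<int f}. [k = n] (mod int d)} \<subseteq> {0..<int m}"
  proof safe
    fix k assume k: "k \<in> {0..<int f}"
    have "int d * (k div int d) + k mod int d = k" "k mod int d \<ge> 0"
      using assms(2) by simp_all
    moreover have "k < int d * int m"
      using k by (simp add: assms(1) mult.commute)
    ultimately have "int d * (k div int d) < int d * int m" by linarith
    then show "k div int d \<in> {0..<int m}"
      using k assms(2) by (simp add: pos_imp_zdiv_nonneg_iff)
  qed
  show "\<forall>k\<in>{k\<in>{0..<int f}. [k = n] (mod int d)}. n mod int d + int d * (k div int d) = k"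
    by (metis (mono_tags, lifting) cong_def mem_Collect_eq mod_mult_div_eq)
qed (use assms in auto)

text \<open>The class is a progression of length f / d starting at n mod d. The two summands are
  never both nonzero, since \<open>log_sine d n\<close> is 0 when d divides n.\<close>

lemma sum_log_sine_residue_class:
  assumes "f > 0" "d dvd f"
  shows "(\<Sum>k | k \<in> {0..<int f} \<and> [k = n] (mod int d). log_sine f k) =
           log_sine d n + (if int d dvd n then ln (real f / real d) else 0)"
proof -
  obtain m where f: "f = m * d" using assms(2) by (metis dvdE mult.commute)
  have pos: "m > 0" "d > 0" using assms(1) f by auto
  have "(\<Sum>k | k \<in> {0..<int f} \<and> [k = n] (mod int d). log_sine f k) =
          (\<Sum>j\<in>{0..<int m}. log_sine f (n mod int d + int d * j))"
    using sum.reindex_bij_betw[OF bij_betw_progression[OF f pos(2,1)], of "log_sine f"] by simp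
  also have "\<dots> = log_sine d (n mod int d) + (if int d dvd n mod int d then ln (real m) else 0)"
    unfolding f using pos by (rule sum_log_sine_progression)
  also have "\<dots> = log_sine d n + (if int d dvd n then ln (real f / real d) else 0)"
    using pos by (simp add: f dvd_mod_iff log_sine_cong[of d "n mod int d" n])
  finally show ?thesis .
qed

section \<open>The logarithm series on the unit circle\<close>

lemma Re_less_1_unit_circle:
  assumes "cmod z = 1" "z \<noteq> 1"
  shows "Re z < 1"
proof (rule ccontr)
  assume "\<not> Re z < 1"
  moreover have "(Re z)\<^sup>2 + (Im z)\<^sup>2 = 1"
    using assms(1) cmod_power2[of z] by simp
  ultimately have "Re z = 1" "Im z = 0"
    using complex_Re_le_cmod[of z] assms(1) by auto
  with assms(2) show False by (simp add: complex_eq_iff)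
qed

text \<open>Abel's theorem is avoided by comparing the partial sums of the series with the logarithm along
  the segment from \<open>0\<close> to \<open>z\<close>: the derivative of the difference at \<open>t z\<close> is \<open>O(t\<^sup>N)\<close>.\<close>

lemma sums_Ln_unit_circle:
  fixes z :: complex
  assumes "cmod z = 1" "z \<noteq> 1"
  shows "(\<lambda>n. z ^ Suc n / of_nat (Suc n)) sums (- Ln (1 - z))"
proof -
  \<comment> \<open>The segment from 0 to z stays away from 1: |1 - z| \<le> |1 - t z| + (1 - t),
    and 1 - t = 1 - |t z| \<le> |1 - t z|, whence the factor 1/2.\<close>
  have bound: "cmod (1 - of_real t * z) \<ge> cmod (1 - z) / 2" if "0 \<le> t" "t \<le> 1" for t
  proof -
    have "cmod (1 - z) \<le> cmod (1 - of_real t * z) + cmod (of_real t * z - z)"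
      using norm_triangle_ineq[of "1 - of_real t * z" "of_real t * z - z"] by simp
    also have "of_real t * z - z = - of_real (1 - t) * z"
      by (simp add: algebra_simps)
    also have "cmod \<dots> = 1 - cmod (of_real t * z)"
      using that assms(1) by (simp add: norm_mult del: of_real_diff)
    also have "\<dots> \<le> cmod (1 - of_real t * z)"
      using norm_triangle_ineq2[of 1 "of_real t * z"] by simp
    finally show ?thesis by simp
  qed
  have "Re z < 1" using assms by (rule Re_less_1_unit_circle)
  \<comment> \<open>This keeps 1 - t z off the branch cut of \<open>Ln\<close> along the whole
    segment.\<close>
  then have Re_pos: "Re (1 - of_real t * z) > 0" if "0 \<le> t" "t \<le> 1" for t
    using that mult_left_le_one_le[of "Re z" t] mult_nonneg_nonpos[of t "Re z"]
    by (cases "Re z > 0"; cases "t = 0"; simp)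
       (smt (verit) mult_left_le_one_le mult_nonneg_nonpos)+
  define C where "C = 2 / cmod (1 - z)"
  have estimate: "cmod ((\<Sum>n<N. z ^ Suc n / of_nat (Suc n)) + Ln (1 - z)) \<le> C / real (Suc N)" for N
  proof -
    \<comment> \<open>\<open>D 1\<close> is the quantity to be estimated and \<open>D 0 = 0\<close>.
      The geometric sum cancels against the derivative of the logarithm up to the single term
      \<open>D'\<close>.\<close>
    define D where "D u = (\<Sum>n<N. (u * z) ^ Suc n / of_nat (Suc n)) + Ln (1 - u * z)" for u
    define D' where "D' u = - (z * (u * z) ^ N / (1 - u * z))" for u
    define E where "E = (\<lambda>t::real. D (of_real t))"
    have deriv: "(E has_vector_derivative D' (of_real t)) (at t)" if t: "0 \<le> t" "t \<le> 1" for t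
      unfolding E_def
    proof (rule has_vector_derivative_real_field)
      let ?u = "complex_of_real t"
      have nonpos: "1 - ?u * z \<notin> \<real>\<^sub>\<le>\<^sub>0"
        using Re_pos[OF t] complex_nonpos_Reals_iff by force
      then have nz: "?u * z \<noteq> 1" by auto
      have summand: "((\<lambda>u. (u * z) ^ Suc n / of_nat (Suc n)) has_field_derivative z * (?u * z) ^ n) (at ?u)"
        for n
      proof -
        have "((\<lambda>u. (u * z) ^ Suc n / of_nat (Suc n)) has_field_derivative
                of_nat (Suc n) * (?u * z) ^ n * z / of_nat (Suc n)) (at ?u)"
          by (auto intro!: derivative_eq_intros simp del: of_nat_Suc power_Suc)
        then show ?thesis by (simp add: mult_ac del: of_nat_Suc)
      qed
      have "(D has_field_derivative (\<Sum>n<N. z * (?u * z) ^ n) + (- z) / (1 - ?u * z)) (at ?u)"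
        unfolding D_def using nonpos
        by (intro DERIV_add DERIV_sum summand) (auto intro!: derivative_eq_intros simp: field_simps)
      moreover have "(\<Sum>n<N. z * (?u * z) ^ n) = z * ((1 - (?u * z) ^ N) / (1 - ?u * z))"
        using nz by (simp add: sum_gp_strict flip: sum_distrib_left)
      moreover have "z * ((1 - (?u * z) ^ N) / (1 - ?u * z)) + (- z) / (1 - ?u * z) = D' ?u"
        unfolding D'_def by (simp add: diff_divide_distrib right_diff_distrib)
      ultimately show "(D has_field_derivative D' ?u) (at ?u)" by simp
    qed
    \<comment> \<open>\<open>C\<close> is the reciprocal of the lower bound |1 - z| / 2, so the
      derivative is at most C t^N; its antiderivative supplies the decay C / (N + 1).\<close>
    have "cmod (E 1 - E 0) \<le> C * 1 ^ Suc N / Suc N - C * 0 ^ Suc N / Suc N"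
    proof (rule differentiable_bound_general[where f = E and f' = "\<lambda>t. D' (of_real t)"
          and \<phi> = "\<lambda>t. C * t ^ Suc N / Suc N" and \<phi>' = "\<lambda>t. C * t ^ N"])
      show "continuous_on {0..1} E"
        using deriv by (intro continuous_at_imp_continuous_on ballI)
          (auto intro: has_vector_derivative_continuous)
      show "((\<lambda>t. C * t ^ Suc N / Suc N) has_vector_derivative C * t ^ N) (at t)" for t :: real
        unfolding has_real_derivative_iff_has_vector_derivative[symmetric]
        by (auto intro!: derivative_eq_intros simp del: of_nat_Suc power_Suc)
      show "(E has_vector_derivative D' (of_real t)) (at t)" if "0 < t" "t < 1" for t
        using deriv that by simp
      show "cmod (D' (of_real t)) \<le> C * t ^ N" if "0 < t" "t < 1" for t
      proof -
        have "cmod (D' (of_real t)) = t ^ N / cmod (1 - of_real t * z)"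
          using that assms(1) by (simp add: D'_def norm_divide norm_mult norm_power)
        also have "\<dots> \<le> t ^ N / (cmod (1 - z) / 2)"
          using that bound[of t] assms(2) by (intro divide_left_mono mult_pos_pos) auto
        finally show ?thesis by (simp add: C_def mult.commute)
      qed
    qed (auto intro!: continuous_intros)
    then show ?thesis by (simp add: E_def D_def)
  qed
  have "(\<lambda>N. (\<Sum>n<N. z ^ Suc n / of_nat (Suc n)) + Ln (1 - z)) \<longlonglongrightarrow> 0"
  proof (rule Lim_null_comparison)
    show "\<forall>\<^sub>F N in sequentially. cmod ((\<Sum>n<N. z ^ Suc n / of_nat (Suc n)) + Ln (1 - z)) \<le> C / real (Suc N)"
      using estimate by simp
    show "(\<lambda>N. C / real (Suc N)) \<longlonglongrightarrow> 0"
      using LIMSEQ_Suc[OF lim_const_over_n[of C]] by simp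
  qed
  then have "(\<lambda>N. ((\<Sum>n<N. z ^ Suc n / of_nat (Suc n)) + Ln (1 - z)) - Ln (1 - z)) \<longlonglongrightarrow> 0 - Ln (1 - z)"
    by (intro tendsto_diff tendsto_const)
  then show ?thesis by (simp add: sums_def)
qed

text \<open>In the right half-plane \<open>Ln\<close> commutes with conjugation, so the imaginary
  parts cancel. For even characters this merges the terms of k and -k into a real logarithm.\<close>

lemma Ln_add_Ln_cnj:
  assumes "Re w > 0"
  shows "Ln w + Ln (cnj w) = of_real (2 * ln (cmod w))"
proof -
  have "w \<notin> \<real>\<^sub>\<le>\<^sub>0" "w \<noteq> 0"
    using assms complex_nonpos_Reals_iff by force+
  then have "Ln w + Ln (cnj w) = of_real (2 * Re (Ln w))"
    by (simp add: cnj_Ln[symmetric] complex_add_cnj)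
  then show ?thesis using \<open>w \<noteq> 0\<close> by (simp add: Re_Ln)
qed

section \<open>Moebius inversion and Ramanujan sums\<close>

lemma prime_factors_prod_primes:
  fixes A :: "nat set"
  assumes "finite A" "\<And>p. p \<in> A \<Longrightarrow> prime p"
  shows "prime_factors (\<Prod>A) = A"
  using assms
proof (induction A rule: finite_induct)
  case (insert p A)
  have "prime p" using insert by simp
  moreover have "\<Prod>A \<noteq> 0" using insert by (auto dest: prime_gt_0_nat)
  ultimately show ?case
    using insert by (simp add: prime_factors_product prime_prime_factors
        prime_factorization_prime prime_gt_0_nat del: prod_zero_iff)
qed simp

lemma prod_prime_factors_squarefree:
  fixes n :: nat
  assumes "squarefree n"
  shows "\<Prod>(prime_factors n) = n"
proof -
  have "n \<noteq> 0" using assms not_squarefree_0 by metis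
  then have "n = (\<Prod>p\<in>prime_factors n. p ^ multiplicity p n)"
    by (intro prime_factorization_nat) simp
  also have "\<dots> = \<Prod>(prime_factors n)"
    using assms \<open>n \<noteq> 0\<close> by (intro prod.cong) (auto simp: squarefree_factorial_semiring')
  finally show ?thesis by simp
qed

lemma squarefree_prod_primes:
  fixes A :: "nat set"
  assumes "\<And>p. p \<in> A \<Longrightarrow> prime p"
  shows "squarefree (\<Prod>A)"
  using assms by (intro squarefree_prod_coprime) (auto intro: primes_coprime squarefree_prime)

text \<open>Only squarefree divisors contribute, and they are the products of sets of primes
  dividing n. In this form the sums are expansions of products over primes and can be treated by
  induction on the set of primes.\<close>

lemma sum_moebius_mu_eq_sum_Pow:
  fixes g :: "nat \<Rightarrow> 'a :: comm_ring_1"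
  assumes "n > 0"
  shows "(\<Sum>d | d dvd n. of_int (moebius_mu d) * g d) =
           (\<Sum>A\<in>Pow (prime_factors n). (- 1) ^ card A * g (\<Prod>A))"
proof -
  have "(\<Sum>d | d dvd n. of_int (moebius_mu d) * g d) =
          (\<Sum>d | d dvd n \<and> squarefree d. (- 1) ^ card (prime_factors d) * g d)"
    using assms by (intro sum.mono_neutral_cong_right) (auto simp: moebius_mu_def)
  also have "\<dots> = (\<Sum>A\<in>Pow (prime_factors n). (- 1) ^ card A * g (\<Prod>A))"
  proof (rule sum.reindex_bij_witness[of _ "\<lambda>A. \<Prod>A" prime_factors])
    fix A assume A: "A \<in> Pow (prime_factors n)"
    then have fin: "finite A" by (auto intro: finite_subset)
    have prime: "prime p" "p dvd n" if "p \<in> A" for p using A that by auto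
    show "prime_factors (\<Prod>A) = A"
      using fin prime(1) by (rule prime_factors_prod_primes)
    have "\<Prod>A dvd (\<Prod>p\<in>prime_factors n. p ^ multiplicity p n)"
      using A prime assms
      by (intro prod_dvd_prod_subset2) (auto intro!: dvd_power simp: multiplicity_gt_zero_iff)
    then have "\<Prod>A dvd n"
      using prime_factorization_nat[OF assms] by simp
    then show "\<Prod>A \<in> {d. d dvd n \<and> squarefree d}"
      using prime by (auto intro: squarefree_prod_primes)
  qed (use assms in \<open>auto simp: prod_prime_factors_squarefree dest: dvd_prime_factors[rotated]\<close>)
  finally show ?thesis .
qed

text \<open>The alternating sum over sets of primes expands the product of 1 - 1 over the primes
  dividing n, which is empty exactly for n = 1.\<close>

lemma sum_moebius_mu_divisors:
  assumes "n > 0"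
  shows "(\<Sum>d | d dvd n. moebius_mu d) = (if n = 1 then 1 else 0)"
proof -
  have "(\<Sum>d | d dvd n. moebius_mu d) = (\<Sum>A\<in>Pow (prime_factors n). (- 1) ^ card A)"
    using sum_moebius_mu_eq_sum_Pow[OF assms, of "\<lambda>_. 1 :: int"] by simp
  also have "\<dots> = (\<Prod>p\<in>prime_factors n. 1 - 1)"
    by (subst prod_diff_conv_sum) simp_all
  also have "\<dots> = (if n = 1 then 1 else 0)"
    using assms by (auto simp: prime_factorization_empty_iff power_0_left card_eq_0_iff)
  finally show ?thesis .
qed

lemma sum_Pow_insert:
  fixes g :: "'a set \<Rightarrow> 'b :: comm_monoid_add"
  assumes "finite P" "q \<notin> P"
  shows "(\<Sum>A\<in>Pow (insert q P). g A) = (\<Sum>A\<in>Pow P. g A + g (insert q A))"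
proof -
  have "(\<Sum>A\<in>Pow (insert q P). g A) = (\<Sum>A\<in>Pow P. g A) + (\<Sum>A\<in>insert q ` Pow P. g A)"
    unfolding Pow_insert using assms by (intro sum.union_disjoint) auto
  also have "(\<Sum>A\<in>insert q ` Pow P. g A) = (\<Sum>A\<in>Pow P. g (insert q A))"
    using assms by (subst sum.reindex) (auto intro!: inj_onI simp: insert_ident)
  finally show ?thesis by (simp add: sum.distrib)
qed

text \<open>The derivative at \<open>s = 1\<close> of \<open>\<Sum>\<^sub>A (-1)\<^bsup>|A|\<^esup> (\<Prod>A)\<^bsup>-s\<^esup> = \<Prod>\<^sub>p (1 - p\<^bsup>-s\<^esup>)\<close>.\<close>

lemma sum_Pow_ln_prod:
  fixes P :: "nat set"
  assumes "finite P" "\<And>p. p \<in> P \<Longrightarrow> p > 1"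
  shows "(\<Sum>A\<in>Pow P. (- 1) ^ card A * (ln (real (\<Prod>A)) / real (\<Prod>A))) =
           - (\<Prod>p\<in>P. 1 - 1 / real p) * (\<Sum>p\<in>P. ln (real p) / (real p - 1))"
  using assms
proof (induction P rule: finite_induct)
  case (insert q P)
  define F :: real where "F = (\<Prod>p\<in>P. 1 - 1 / real p)"
  define H :: real where "H = (\<Sum>A\<in>Pow P. (- 1) ^ card A * (ln (real (\<Prod>A)) / real (\<Prod>A)))"
  have F: "F = (\<Sum>A\<in>Pow P. (- 1) ^ card A * (1 / real (\<Prod>A)))"
    unfolding F_def using insert.hyps
    by (subst prod_diff_conv_sum) (simp_all add: prod_dividef)
  have q: "q > 1" using insert by simp
  \<comment> \<open>The logarithm of q times the product of A splits additively, so the subsets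
    containing q contribute - H / q - (log q / q) F.\<close>
  have step: "(- 1) ^ card (insert q A) * (ln (real (\<Prod>(insert q A))) / real (\<Prod>(insert q A))) =
          - (1 / real q) * ((- 1) ^ card A * (ln (real (\<Prod>A)) / real (\<Prod>A)))
          - (ln q / q) * ((- 1) ^ card A * (1 / real (\<Prod>A)))"
    if "A \<in> Pow P" for A
  proof -
    have A: "finite A" "q \<notin> A" "\<And>p. p \<in> A \<Longrightarrow> p > 0"
      using that insert by (auto intro: finite_subset dest: gr_implies_not0)
    define r where "r = real (\<Prod>A)"
    have "r > 0" unfolding r_def using A(3) by (auto intro: prod_pos)
    moreover have "real (\<Prod>(insert q A)) = real q * r"
      using A by (simp add: r_def)
    ultimately show ?thesis
      using A(1,2) q unfolding r_def[symmetric] by (simp add: ln_mult field_simps)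
  qed
  have "(\<Sum>A\<in>Pow (insert q P). (- 1) ^ card A * (ln (real (\<Prod>A)) / real (\<Prod>A))) =
          H + (- (1 / real q) * H - (ln q / q) * F)"
    unfolding sum_Pow_insert[OF insert.hyps(1,2)] sum.distrib H_def F sum_distrib_left
      sum_subtractf[symmetric] using step by (intro arg_cong2[of _ _ _ _ "(+)"] refl sum.cong) auto
  \<comment> \<open>Since log q / q = (1 - 1 / q) log q / (q - 1), the new term shares the enlarged
    product as a factor.\<close>
  also have "\<dots> = - ((1 - 1 / real q) * F) * (ln q / (real q - 1) + (\<Sum>p\<in>P. ln (real p) / (real p - 1)))"
  proof -
    have "H = - F * (\<Sum>p\<in>P. ln (real p) / (real p - 1))"
      using insert unfolding H_def F_def by simp
    moreover have "real q - 1 \<noteq> 0" "real q \<noteq> 0" using q by auto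
    ultimately show ?thesis by (simp add: divide_simps) (simp add: algebra_simps)
  qed
  also have "\<dots> = - (\<Prod>p\<in>insert q P. 1 - 1 / real p) * (\<Sum>p\<in>insert q P. ln (real p) / (real p - 1))"
    using insert.hyps by (simp add: F_def)
  finally show ?case .
qed simp

lemma sum_moebius_mu_ln:
  assumes "n > 0"
  shows "(\<Sum>d | d dvd n. of_int (moebius_mu d) * (ln (real d) / real d)) =
           - (real (totient n) / real n * (\<Sum>p | prime p \<and> p dvd n. ln (real p) / (real p - 1)))"
proof -
  have "prime_factors n = {p. prime p \<and> p dvd n}"
    using assms by (auto simp: prime_factors_dvd)
  moreover have "real (totient n) / real n = (\<Prod>p\<in>prime_factors n. 1 - 1 / real p)"
    using assms by (simp add: totient_formula2)
  moreover have "(\<Sum>d | d dvd n. of_int (moebius_mu d) * (ln (real d) / real d)) =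
      - (\<Prod>p\<in>prime_factors n. 1 - 1 / real p) * (\<Sum>p\<in>prime_factors n. ln (real p) / (real p - 1))"
    using assms by (subst sum_moebius_mu_eq_sum_Pow, simp, intro sum_Pow_ln_prod)
      (auto dest!: in_prime_factors_imp_prime prime_gt_Suc_0_nat)
  ultimately show ?thesis by simp
qed

lemma sum_divisors_flip:
  fixes f :: nat
  assumes "f > 0"
  shows "(\<Sum>d | d dvd f. g d (f div d)) = (\<Sum>d | d dvd f. g (f div d) d)"
  by (rule sum.reindex_bij_witness[of _ "\<lambda>d. f div d" "\<lambda>d. f div d"])
     (use assms in \<open>auto elim!: dvdE\<close>)

text \<open>Coprimality of a and f is detected by the sum of mu(e) over the common divisors e. The
  multiples of e then form a complete additive character sum modulo f / e, equal to f / e or 0;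
  finally d = f / e.\<close>

lemma ramanujan_sum:
  assumes "f > 0"
  shows "(\<Sum>a | a \<in> {0..<int f} \<and> coprime a (int f). add_char f (a * n)) =
           (\<Sum>d | d dvd f. of_int (moebius_mu (f div d)) * of_nat d * (if int d dvd n then 1 else 0))"
proof -
  have indicator: "(\<Sum>e | e dvd f. if int e dvd a then moebius_mu e else 0) =
      (if coprime a (int f) then 1 else 0)" for a
  proof -
    let ?g = "nat (gcd a (int f))"
    have dvd: "e dvd ?g \<longleftrightarrow> e dvd f \<and> int e dvd a" for e
    proof -
      have "e dvd ?g \<longleftrightarrow> int e dvd gcd a (int f)"
        by (simp flip: int_dvd_int_iff)
      then show ?thesis by auto
    qed
    have "(\<Sum>e | e dvd f. if int e dvd a then moebius_mu e else 0) = (\<Sum>e | e dvd ?g. moebius_mu e)"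
      using assms by (intro sum.mono_neutral_cong_right) (auto simp: dvd)
    also have "\<dots> = (if ?g = 1 then 1 else 0)"
      using assms by (intro sum_moebius_mu_divisors) simp
    also have "\<dots> = (if coprime a (int f) then 1 else 0)"
      by (simp add: coprime_iff_gcd_eq_1)
    finally show ?thesis .
  qed
  have multiples: "(\<Sum>a | a \<in> {0..<int f} \<and> int e dvd a. add_char f (a * n)) =
      of_nat (f div e) * (if int (f div e) dvd n then 1 else 0)" if e: "e dvd f" for e
  proof -
    obtain d where f: "f = e * d" using e by (rule dvdE)
    have pos: "e > 0" "d > 0" using assms f by auto
    have "(\<Sum>a | a \<in> {0..<int f} \<and> int e dvd a. add_char f (a * n)) =
            (\<Sum>j\<in>{0..<int d}. add_char (e * d) (int e * (j * n)))"
      by (rule sum.reindex_bij_witness[of _ "\<lambda>j. int e * j" "\<lambda>a. a div int e"])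
         (use pos in \<open>auto simp: f zero_le_mult_iff mult_ac elim!: dvdE\<close>)
    also have "\<dots> = (\<Sum>j\<in>{0..<int d}. add_char d (j * n))"
      using pos by (simp only: add_char_mult_left)
    also have "\<dots> = of_nat d * (if int d dvd n then 1 else 0)"
      using pos by (simp add: sum_add_char)
    finally show ?thesis using pos f by simp
  qed
  have "(\<Sum>a | a \<in> {0..<int f} \<and> coprime a (int f). add_char f (a * n)) =
          (\<Sum>a\<in>{0..<int f}. of_int (if coprime a (int f) then 1 else 0) * add_char f (a * n))"
    by (rule sum.mono_neutral_cong_left) auto
  also have "\<dots> = (\<Sum>a\<in>{0..<int f}. \<Sum>e | e dvd f.
                     if int e dvd a then of_int (moebius_mu e) * add_char f (a * n) else 0)"
    unfolding indicator[symmetric] of_int_sum sum_distrib_right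
    by (intro sum.cong refl) simp
  also have "\<dots> = (\<Sum>e | e dvd f. \<Sum>a\<in>{0..<int f}.
                     if int e dvd a then of_int (moebius_mu e) * add_char f (a * n) else 0)"
    by (rule sum.swap)
  also have "\<dots> = (\<Sum>e | e dvd f. of_int (moebius_mu e) *
                     (\<Sum>a | a \<in> {0..<int f} \<and> int e dvd a. add_char f (a * n)))"
    unfolding sum_distrib_left by (intro sum.cong refl sum.mono_neutral_cong_right) auto
  also have "\<dots> = (\<Sum>e | e dvd f. of_int (moebius_mu e) *
                     (of_nat (f div e) * (if int (f div e) dvd n then 1 else 0)))"
    using multiples by simp
  also have "\<dots> = (\<Sum>d | d dvd f. of_int (moebius_mu (f div d)) *
                     (of_nat d * (if int d dvd n then 1 else 0)))"
    using sum_divisors_flip[OF assms, of "\<lambda>e d. of_int (moebius_mu e) *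
                     (of_nat d * (if int d dvd n then 1 else 0)) :: complex"] .
  finally show ?thesis by (simp add: mult.assoc)
qed

section \<open>Orthogonality of Dirichlet characters\<close>

text \<open>A unit permutes the residues. It is applied with the unit -1 for parity arguments and
  with a unit b where \<open>chi b\<close> differs from 1.\<close>

lemma sum_residues_mult:
  fixes h :: "int \<Rightarrow> 'a :: comm_monoid_add"
  assumes "f > 0" "coprime c (int f)" "\<And>m n. [m = n] (mod int f) \<Longrightarrow> h m = h n"
  shows "(\<Sum>a\<in>{0..<int f}. h (c * a)) = (\<Sum>a\<in>{0..<int f}. h a)"
proof -
  have inj: "inj_on (\<lambda>a. c * a mod int f) {0..<int f}"
  proof (rule inj_onI)
    fix a b assume ab: "a \<in> {0..<int f}" "b \<in> {0..<int f}" "c * a mod int f = c * b mod int f"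
    then have "[a = b] (mod int f)"
      using assms(2) cong_mult_lcancel[of c "int f" a b] by (simp add: cong_def)
    with ab show "a = b" by (simp add: cong_def)
  qed
  moreover have "(\<lambda>a. c * a mod int f) ` {0..<int f} \<subseteq> {0..<int f}"
    using assms(1) by auto
  ultimately have img: "(\<lambda>a. c * a mod int f) ` {0..<int f} = {0..<int f}"
    by (intro endo_inj_surj) auto
  have "(\<Sum>a\<in>{0..<int f}. h (c * a)) = (\<Sum>a\<in>{0..<int f}. h (c * a mod int f))"
    by (intro sum.cong refl assms(3)) (simp add: cong_def)
  also have "\<dots> = (\<Sum>a\<in>(\<lambda>a. c * a mod int f) ` {0..<int f}. h a)"
    using inj by (simp add: sum.reindex)
  finally show ?thesis by (simp only: img)
qed

lemma dirichlet_character_mult: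
  "dirichlet_character f chi \<Longrightarrow> chi (m * n) = chi m * chi n"
  by (simp add: dirichlet_character_def)

lemma dirichlet_character_eq_0_iff:
  "dirichlet_character f chi \<Longrightarrow> chi n = 0 \<longleftrightarrow> \<not> coprime n (int f)"
  by (auto simp: dirichlet_character_def)

lemma dirichlet_character_1: 
  assumes "dirichlet_character f chi"
  shows "chi 1 = 1"
  using dirichlet_character_mult[OF assms, of 1 1] dirichlet_character_eq_0_iff[OF assms, of 1]
  by simp

lemma dirichlet_character_power:
  assumes "dirichlet_character f chi"
  shows "chi (n ^ k) = chi n ^ k"
  by (induction k) (simp_all add: dirichlet_character_1[OF assms] dirichlet_character_mult[OF assms])

lemma dirichlet_character_cong:
  assumes "dirichlet_character f chi" "[m = n] (mod int f)"
  shows "chi m = chi n"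
proof -
  have nat_mult: "chi (m + int k * int f) = chi m" for m k
  proof (induction k)
    case (Suc k)
    have "chi (m + int (Suc k) * int f) = chi ((m + int k * int f) + int f)"
      by (simp add: algebra_simps)
    with Suc assms(1) show ?case by (simp add: dirichlet_character_def)
  qed simp
  obtain q where q: "n = m + int f * q"
    using assms(2) by (auto simp: cong_iff_lin)
  show ?thesis
    using nat_mult[of m "nat q"] nat_mult[of n "nat (- q)"] q
    by (cases "q \<ge> 0") (simp_all add: mult.commute)
qed

lemma euler_theorem_int:
  assumes "f > 0" "coprime n (int f)"
  shows "[n ^ totient f = 1] (mod int f)"
proof -
  define m where "m = nat (n mod int f)"
  have m: "int m = n mod int f" using assms by (simp add: m_def)
  have "coprime (int m) (int f)"
    using assms by (simp add: m coprime_mod_left_iff)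
  then have "[m ^ totient f = 1] (mod f)"
    by (intro euler_theorem) simp
  then have "[int m ^ totient f = 1] (mod int f)"
    using cong_int_iff[of "m ^ totient f" 1 f] by simp
  moreover have "[n ^ totient f = int m ^ totient f] (mod int f)"
    by (intro cong_pow) (simp add: m)
  ultimately show ?thesis by (rule cong_trans[rotated])
qed

lemma norm_dirichlet_character:
  assumes "f > 0" "dirichlet_character f chi" "coprime n (int f)"
  shows "cmod (chi n) = 1"
proof -
  have "chi n ^ totient f = 1"
    using dirichlet_character_cong[OF assms(2) euler_theorem_int[OF assms(1,3)]]
    by (simp add: dirichlet_character_power[OF assms(2)] dirichlet_character_1[OF assms(2)])
  then show ?thesis
    using assms(1) power_eq_1_iff[of "cmod (chi n)" "totient f"] by (simp flip: norm_power)
qed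

lemma dirichlet_character_cnj_mult:
  assumes "f > 0" "dirichlet_character f chi" "coprime n (int f)"
  shows "cnj (chi n) * chi n = 1"
  using norm_dirichlet_character[OF assms] complex_norm_square[of "chi n"] by (simp add: mult.commute)

lemma coprime_add_self_iff: "coprime (m + n) n \<longleftrightarrow> coprime m (n :: int)"
  by (metis coprime_iff_gcd_eq_1 gcd_add1)

lemma dirichlet_character_trivial: "dirichlet_character f (trivial_character f)"
  by (auto simp: dirichlet_character_def trivial_character_def coprime_add_self_iff)

text \<open>To separate residues by characters, project the delta function at \<open>1\<close> onto simultaneous
  eigenspaces of the multiplication operators: a nonzero function that is an eigenfunction for every
  unit has a character as its system of eigenvalues.\<close>

definition eigenfunction :: "(int \<Rightarrow> complex) \<Rightarrow> int \<Rightarrow> complex \<Rightarrow> bool" where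
  "eigenfunction F x \<mu> \<longleftrightarrow> (\<forall>h. F (x * h) = \<mu> * F h)"

text \<open>Unnormalised: when x^n is 1 modulo the period of \<open>F\<close>, this is n times the
  projection of \<open>F\<close> to the eigenvalue e(j / n) of the operator sending \<open>F\<close>
  to h \<mapsto> F(x h).\<close>

definition eigen_projection ::
    "nat \<Rightarrow> (int \<Rightarrow> complex) \<Rightarrow> int \<Rightarrow> nat \<Rightarrow> int \<Rightarrow> complex" where
  "eigen_projection n F x j h = (\<Sum>k<n. add_char n (- (int j * int k)) * F (x ^ k * h))"

text \<open>The eigenvalue comes from a cyclic shift of k, the decomposition of \<open>F\<close>
  from orthogonality in j, and the last claim from the fact that multiplications by x and y
  commute.\<close>

lemma eigen_projections:
  fixes F :: "int \<Rightarrow> complex" and x :: int and n :: nat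
  defines "P \<equiv> eigen_projection n F x"
  assumes "f > 0" and F: "\<And>a b. [a = b] (mod int f) \<Longrightarrow> F a = F b"
    and x: "[x ^ n = 1] (mod int f)" and "n > 0"
  shows "\<And>a b. [a = b] (mod int f) \<Longrightarrow> P j a = P j b"
    and "eigenfunction (P j) x (add_char n (int j))"
    and "(\<Sum>j<n. P j h) = of_nat n * F h"
    and "eigenfunction F y \<mu> \<Longrightarrow> eigenfunction (P j) y \<mu>"
proof -
  show "P j a = P j b" if "[a = b] (mod int f)" for a b
    unfolding P_def eigen_projection_def using that by (intro sum.cong refl arg_cong2[of _ _ _ _ "(*)"] F cong_mult) auto
  show "eigenfunction (P j) x (add_char n (int j))"
    unfolding eigenfunction_def
  proof
    fix h
    define G where "G k = add_char n (- (int j * int k)) * F (x ^ k * h)" for k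
    \<comment> \<open>The cycle closes because x^n is 1 modulo f, so shifting k by one leaves the
      sum unchanged.\<close>
    have "G n = G 0"
    proof -
      have "F (x ^ n * h) = F (1 * h)" by (intro F cong_mult x cong_refl)
      moreover have "add_char n (- (int j * int n)) = 1"
        using \<open>n > 0\<close> by (simp add: add_char_eq_1_iff)
      ultimately show ?thesis by (simp add: G_def)
    qed
    then have "(\<Sum>k<n. G (Suc k)) = (\<Sum>k<n. G k)"
      using sum.lessThan_Suc_shift[of G n] by simp
    moreover have "add_char n (- (int j * int k)) * F (x ^ k * (x * h)) = add_char n (int j) * G (Suc k)" for k
    proof -
      have "add_char n (- (int j * int k)) = add_char n (int j) * add_char n (- (int j * int (Suc k)))"
        by (simp add: algebra_simps flip: add_char_add)
      then show ?thesis by (simp add: G_def mult_ac)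
    qed
    ultimately show "P j (x * h) = add_char n (int j) * P j h"
      by (simp add: P_def eigen_projection_def sum_distrib_left[symmetric] G_def)
  qed
  show "(\<Sum>j<n. P j h) = of_nat n * F h"
  proof -
    have "(\<Sum>j<n. P j h) = (\<Sum>k<n. (\<Sum>j<n. add_char n (- (int j * int k))) * F (x ^ k * h))"
      unfolding P_def eigen_projection_def by (subst sum.swap) (simp add: sum_distrib_right)
    also have "\<dots> = (\<Sum>k<n. if k = 0 then of_nat n * F h else 0)"
    proof (intro sum.cong refl)
      fix k assume k: "k \<in> {..<n}"
      have "(\<Sum>j<n. add_char n (- (int j * int k))) = (\<Sum>j\<in>{0..<int n}. add_char n (j * (- int k)))"
        by (rule sum.reindex_bij_witness[of _ nat int]) auto
      also have "\<dots> = (if int n dvd - int k then of_nat n else 0)"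
        using \<open>n > 0\<close> by (rule sum_add_char)
      also have "int n dvd - int k \<longleftrightarrow> k = 0"
        using k by (auto dest: nat_dvd_not_less)
      finally show "(\<Sum>j<n. add_char n (- (int j * int k))) * F (x ^ k * h) =
          (if k = 0 then of_nat n * F h else 0)" by simp
    qed
    finally show ?thesis using \<open>n > 0\<close> by simp
  qed
  show "eigenfunction (P j) y \<mu>" if "eigenfunction F y \<mu>"
    unfolding eigenfunction_def
  proof
    fix h
    have "F (x ^ k * (y * h)) = \<mu> * F (x ^ k * h)" for k
      using that unfolding eigenfunction_def by (metis mult.left_commute)
    then show "P j (y * h) = \<mu> * P j h"
      by (simp add: P_def eigen_projection_def sum_distrib_left mult_ac)
  qed
qed

text \<open>One unit is diagonalised at a time. The projections add up to a positive multiple of the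
  current function, so one of them is nonzero at the fixed point \<open>g\<close>; the eigenvalues
  already obtained survive the projection.\<close>

lemma simultaneous_eigenfunction:
  assumes "f > 0" "finite X" "\<And>x. x \<in> X \<Longrightarrow> coprime x (int f)"
    and "\<And>a b. [a = b] (mod int f) \<Longrightarrow> F a = F b" "F g \<noteq> 0"
  shows "\<exists>F'. (\<forall>a b. [a = b] (mod int f) \<longrightarrow> F' a = F' b) \<and> F' g \<noteq> 0 \<and>
           (\<forall>y \<mu>. eigenfunction F y \<mu> \<longrightarrow> eigenfunction F' y \<mu>) \<and>
           (\<forall>x\<in>X. \<exists>\<mu>. eigenfunction F' x \<mu>)"
  using assms(2,3)
proof (induction X rule: finite_induct)
  case empty
  show ?case using assms(4,5) by (intro exI[of _ F]) auto
next
  case (insert x X)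
  then obtain G where G: "\<And>a b. [a = b] (mod int f) \<Longrightarrow> G a = G b" "G g \<noteq> 0"
    "\<And>y \<mu>. eigenfunction F y \<mu> \<Longrightarrow> eigenfunction G y \<mu>" "\<And>x. x \<in> X \<Longrightarrow> \<exists>\<mu>. eigenfunction G x \<mu>"
    by (metis insertI2)
  define n where "n = totient f"
  have n: "n > 0" using assms(1) by (simp add: n_def)
  have x: "[x ^ n = 1] (mod int f)"
    unfolding n_def using assms(1) insert.prems by (intro euler_theorem_int) auto
  define P where "P = eigen_projection n G x"
  note proj = eigen_projections[where F = G and f = f and x = x and n = n, folded P_def,
      OF assms(1) _ x n]
  have "\<exists>j. P j g \<noteq> 0"
  proof (rule ccontr)
    assume "\<nexists>j. P j g \<noteq> 0"
    then have "of_nat n * G g = 0" using proj(3)[OF G(1), of g] by simp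
    with n G(2) show False by simp
  qed
  then obtain j where j: "P j g \<noteq> 0" ..
  show ?case
  proof (rule exI[of _ "P j"], intro conjI allI impI ballI)
    fix a b assume "[a = b] (mod int f)"
    with G(1) show "P j a = P j b" by (rule proj(1))
  next
    fix y \<mu> assume "eigenfunction F y \<mu>"
    then show "eigenfunction (P j) y \<mu>" by (intro proj(4)[OF G(1)] G(3))
  next
    fix y assume "y \<in> insert x X"
    then show "\<exists>\<mu>. eigenfunction (P j) y \<mu>"
      using proj(2)[OF G(1), of j] proj(4)[OF G(1), of y _ j] G(4)[of y] by blast
  qed (fact j)
qed

lemma dirichlet_character_separates:
  assumes "f > 0" "coprime a (int f)" "\<not> [a = 1] (mod int f)"
  obtains chi where "dirichlet_character f chi" "chi a \<noteq> 1"
proof -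
  define n where "n = totient f"
  have n: "n > 0" using assms(1) by (simp add: n_def)
  have euler: "[x ^ n = 1] (mod int f)" if "coprime x (int f)" for x
    unfolding n_def using assms(1) that by (rule euler_theorem_int)
  \<comment> \<open>The delta function at the class of 1 is not invariant under multiplication by
    \<open>a\<close>, so it must have a component whose eigenvalue at \<open>a\<close> is not
    1.\<close>
  define D where "D h = (if [h = 1] (mod int f) then 1 else 0 :: complex)" for h
  have D: "D x = D y" if "[x = y] (mod int f)" for x y
    using that unfolding D_def by (metis cong_sym cong_trans)
  define P where "P = eigen_projection n D a"
  note proj = eigen_projections[where F = D and f = f and x = a and n = n, folded P_def,
      OF assms(1) _ euler[OF assms(2)] n]
  have "\<exists>j h. add_char n (int j) \<noteq> 1 \<and> P j h \<noteq> 0"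
  proof (rule ccontr)
    \<comment> \<open>Otherwise only j = 0 survives and \<open>D\<close> is fixed by
      \<open>a\<close>, which contradicts \<open>D a = 0\<close> and \<open>D 1 = 1\<close>.\<close>
    assume neg: "\<nexists>j h. add_char n (int j) \<noteq> 1 \<and> P j h \<noteq> 0"
    have "of_nat n * D h = P 0 h" for h
    proof -
      have "P j h = 0" if "j \<in> {..<n} - {0}" for j
      proof -
        have "add_char n (int j) \<noteq> 1"
          using that n by (auto simp: add_char_eq_1_iff dest: nat_dvd_not_less)
        with neg show ?thesis by blast
      qed
      then have "(\<Sum>j<n. P j h) = P 0 h"
        using n by (subst sum.remove[of _ 0]) auto
      then show ?thesis by (simp add: proj(3)[OF D])
    qed
    moreover have "P 0 (a * 1) = P 0 1"
      using proj(2)[OF D, of 0] unfolding eigenfunction_def by (metis add_char_0 mult_1 of_nat_0)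
    ultimately have "of_nat n * D a = of_nat n * D 1" by simp
    with n assms(3) show False by (simp add: D_def)
  qed
  then obtain j g where j: "add_char n (int j) \<noteq> 1" "P j g \<noteq> 0" by blast
  \<comment> \<open>Finitely many representatives suffice: by periodicity of \<open>F\<close>, a
    unit acts as its residue does.\<close>
  define X where "X = {x \<in> {0..<int f}. coprime x (int f)}"
  have "finite X" "\<And>x. x \<in> X \<Longrightarrow> coprime x (int f)"
    by (auto simp: X_def intro: finite_subset[of _ "{0..<int f}"])
  from simultaneous_eigenfunction[where F = "P j", OF assms(1) this proj(1)[OF D] j(2)]
  obtain F where F: "\<And>x y. [x = y] (mod int f) \<Longrightarrow> F x = F y" "F g \<noteq> 0"
    and F': "\<And>y \<mu>. eigenfunction (P j) y \<mu> \<Longrightarrow> eigenfunction F y \<mu>"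
    and eig: "\<And>x. x \<in> X \<Longrightarrow> \<exists>\<mu>. eigenfunction F x \<mu>"
    by metis
  note Fa = F'[OF proj(2)[OF D]]
  have eig': "\<exists>\<mu>. eigenfunction F x \<mu>" if x: "coprime x (int f)" for x
  proof -
    obtain \<mu> where "eigenfunction F (x mod int f) \<mu>"
      using eig[of "x mod int f"] assms(1) x by (auto simp: X_def)
    moreover have "F (x * h) = F (x mod int f * h)" for h
      by (intro F(1) cong_mult) auto
    ultimately show ?thesis by (auto simp: eigenfunction_def)
  qed
  \<comment> \<open>On units, \<open>chi x\<close> is the eigenvalue of x, so multiplicativity is
    composition of the operators.\<close>
  define chi where "chi x = (if coprime x (int f) then F (x * g) / F g else 0)" for x
  have chi: "chi x = \<mu>" if "coprime x (int f)" "eigenfunction F x \<mu>" for x \<mu>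
    using that F(2) by (simp add: chi_def eigenfunction_def)
  have "dirichlet_character f chi"
    unfolding dirichlet_character_def
  proof (intro conjI allI)
    fix x y :: int
    show "chi (x * y) = chi x * chi y"
    proof (cases "coprime x (int f) \<and> coprime y (int f)")
      case True
      then obtain \<mu> \<nu> where "eigenfunction F x \<mu>" "eigenfunction F y \<nu>" using eig' by blast
      moreover from this have "eigenfunction F (x * y) (\<mu> * \<nu>)"
        by (simp add: eigenfunction_def mult.assoc)
      ultimately show ?thesis using True by (simp add: chi)
    next
      case False
      then show ?thesis by (auto simp: chi_def)
    qed
  next
    fix x :: int
    have "F ((x + int f) * g) = F (x * g)"
      by (intro F(1) cong_mult) (auto simp: cong_def)
    moreover have "coprime (x + int f) (int f) \<longleftrightarrow> coprime x (int f)"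
      by (rule coprime_add_self_iff)
    ultimately show "chi (x + int f) = chi x" by (simp add: chi_def)
  next
    fix x :: int
    show "chi x \<noteq> 0 \<longleftrightarrow> coprime x (int f)"
    proof
      assume x: "coprime x (int f)"
      then obtain \<mu> where \<mu>: "eigenfunction F x \<mu>" using eig' by blast
      \<comment> \<open>Eigenvalues at units are roots of unity, hence nonzero.\<close>
      have "F (x ^ k * g) = \<mu> ^ k * F g" for k
        using \<mu> by (induction k) (simp_all add: eigenfunction_def mult.assoc)
      moreover have "F (x ^ n * g) = F (1 * g)"
        using euler[OF x] by (intro F(1) cong_mult) auto
      ultimately have "\<mu> ^ n = 1" using F(2) by simp
      then have "\<mu> \<noteq> 0" using n by (auto simp: power_0_left)
      then show "chi x \<noteq> 0" using chi[OF x \<mu>] by simp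
    qed (simp add: chi_def split: if_splits)
  qed
  moreover have "chi a \<noteq> 1"
    using chi[OF assms(2) Fa] j(1) by simp
  ultimately show thesis by (rule that)
qed

section \<open>Sums over residues and over characters\<close>

lemma sum_dirichlet_character:
  assumes "f > 0" "dirichlet_character f chi" "chi \<noteq> trivial_character f"
  shows "(\<Sum>a\<in>{0..<int f}. chi a) = 0"
proof -
  obtain b where "chi b \<noteq> trivial_character f b" using assms(3) by blast
  then have b: "coprime b (int f)" "chi b \<noteq> 1"
    using dirichlet_character_eq_0_iff[OF assms(2), of b]
    by (auto simp: trivial_character_def split: if_splits)
  have "(\<Sum>a\<in>{0..<int f}. chi (b * a)) = (\<Sum>a\<in>{0..<int f}. chi a)"
    using assms(1) b(1) dirichlet_character_cong[OF assms(2)] by (rule sum_residues_mult)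
  then have "(chi b - 1) * (\<Sum>a\<in>{0..<int f}. chi a) = 0"
    by (simp add: dirichlet_character_mult[OF assms(2)] left_diff_distrib flip: sum_distrib_left)
  with b(2) show ?thesis by simp
qed

text \<open>Multiplication by a separating character \<open>psi\<close> permutes the characters,
  with inverse multiplication by its conjugate, and scales the sum by \<open>psi a\<close> \<noteq>
  1.\<close>

lemma sum_over_dirichlet_characters:
  assumes "f > 0" "coprime a (int f)" "\<not> [a = 1] (mod int f)"
  shows "(\<Sum>chi | dirichlet_character f chi. chi a) = 0"
proof -
  obtain psi where psi: "dirichlet_character f psi" "psi a \<noteq> 1"
    using dirichlet_character_separates[OF assms] .
  have inv: "cnj (psi n) * (psi n * chi n) = chi n" "psi n * (cnj (psi n) * chi n) = chi n"
    if "dirichlet_character f chi" for chi n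
  proof -
    show "cnj (psi n) * (psi n * chi n) = chi n"
      using dirichlet_character_cnj_mult[OF assms(1) psi(1), of n] dirichlet_character_eq_0_iff[OF that, of n]
      by (cases "coprime n (int f)") (simp_all flip: mult.assoc)
    then show "psi n * (cnj (psi n) * chi n) = chi n"
      by (simp only: mult.left_commute)
  qed
  have "(\<Sum>chi | dirichlet_character f chi. chi a) = (\<Sum>chi | dirichlet_character f chi. psi a * chi a)"
    by (rule sum.reindex_bij_witness[of _ "\<lambda>chi n. psi n * chi n" "\<lambda>chi n. cnj (psi n) * chi n"])
       (use psi(1) inv in \<open>auto simp: dirichlet_character_def fun_eq_iff\<close>)
  then have "(psi a - 1) * (\<Sum>chi | dirichlet_character f chi. chi a) = 0"
    by (simp add: left_diff_distrib flip: sum_distrib_left)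
  with psi(2) show ?thesis by simp
qed

lemma card_coprime_residues:
  assumes "f > 1"
  shows "card {a \<in> {0..<int f}. coprime a (int f)} = totient f"
proof -
  \<comment> \<open>For f > 1 neither 0 nor f is coprime to f, so the ranges 0..f-1 and 1..f contain
    the same units.\<close>
  have "bij_betw int (totatives f) {a \<in> {0..<int f}. coprime a (int f)}"
  proof (rule bij_betw_byWitness[of _ nat])
    show "int ` totatives f \<subseteq> {a \<in> {0..<int f}. coprime a (int f)}"
      using assms by (auto simp: totatives_def intro: le_neq_trans)
    show "nat ` {a \<in> {0..<int f}. coprime a (int f)} \<subseteq> totatives f"
    proof safe
      fix a assume a: "a \<in> {0..<int f}" "coprime a (int f)"
      then have "a \<noteq> 0" using assms by (intro notI) simp
      with a show "nat a \<in> totatives f" by (auto simp: totatives_def coprime_int_iff[symmetric] simp del: coprime_int_iff)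
    qed
  qed auto
  then show ?thesis
    using bij_betw_same_card[of int] by (simp add: totient_def)
qed

text \<open>Double counting of chi(a) over all a and all characters: summing over characters first
  leaves only a = 1, summing over residues first leaves only the trivial character.\<close>

lemma card_dirichlet_characters:
  assumes "f > 1"
  shows "card {chi. dirichlet_character f chi} = totient f"
proof -
  let ?X = "{chi. dirichlet_character f chi}"
  have f: "f > 0" using assms by simp
  have zero: "(\<Sum>chi\<in>?X. chi a) = 0" if "a \<in> {0..<int f}" "a \<noteq> 1" for a
  proof (cases "coprime a (int f)")
    case True
    moreover have "\<not> [a = 1] (mod int f)" using that assms by (simp add: cong_def)
    ultimately show ?thesis using f by (intro sum_over_dirichlet_characters)
  next
    case False
    then show ?thesis by (intro sum.neutral) (auto simp: dirichlet_character_eq_0_iff)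
  qed
  have "of_nat (card ?X) = (\<Sum>chi\<in>?X. chi 1)"
    by (simp add: dirichlet_character_1)
  also have "\<dots> = (\<Sum>a\<in>{0..<int f}. \<Sum>chi\<in>?X. chi a)"
  proof -
    have "(\<Sum>a\<in>{0..<int f}. \<Sum>chi\<in>?X. chi a) =
        (\<Sum>chi\<in>?X. chi 1) + (\<Sum>a\<in>{0..<int f} - {1}. \<Sum>chi\<in>?X. chi a)"
      using assms by (intro sum.remove) auto
    also have "(\<Sum>a\<in>{0..<int f} - {1}. \<Sum>chi\<in>?X. chi a) = 0"
      using zero by (intro sum.neutral) auto
    finally show ?thesis by simp
  qed
  also have "\<dots> = (\<Sum>chi\<in>?X. \<Sum>a\<in>{0..<int f}. chi a)"
    by (rule sum.swap)
  also have "\<dots> = (\<Sum>a\<in>{0..<int f}. trivial_character f a)"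
  proof -
    have "(\<Sum>chi\<in>?X. \<Sum>a\<in>{0..<int f}. chi a) = (\<Sum>a\<in>{0..<int f}. trivial_character f a) +
        (\<Sum>chi\<in>?X - {trivial_character f}. \<Sum>a\<in>{0..<int f}. chi a)"
      using finite_dirichlet_characters[OF f] dirichlet_character_trivial by (intro sum.remove) auto
    also have "(\<Sum>chi\<in>?X - {trivial_character f}. \<Sum>a\<in>{0..<int f}. chi a) = 0"
      using f by (intro sum.neutral ballI sum_dirichlet_character) auto
    finally show ?thesis by simp
  qed
  also have "\<dots> = (\<Sum>a | a \<in> {0..<int f} \<and> coprime a (int f). 1)"
    by (rule sum.mono_neutral_cong_right) (auto simp: trivial_character_def)
  also have "\<dots> = of_nat (totient f)"
    using card_coprime_residues[OF assms] by simp
  finally show ?thesis by (simp only: of_nat_eq_iff)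
qed

text \<open>For units, the conjugate of chi(b) is chi of an inverse b' of b modulo f, which reduces
  the claim to the character sum at a b'.\<close>

lemma dirichlet_characters_orthogonal:
  assumes "f > 1"
  shows "(\<Sum>chi | dirichlet_character f chi. chi a * cnj (chi b)) =
           (if coprime a (int f) \<and> [a = b] (mod int f) then of_nat (totient f) else 0)"
proof (cases "coprime a (int f) \<and> coprime b (int f)")
  case True
  have f: "f > 0" using assms by simp
  obtain b' where b': "[b * b' = 1] (mod int f)"
    using True cong_solve_coprime_int by blast
  have "coprime b' (int f)"
    using b' by (metis cong_imp_coprime cong_sym coprime_1_left coprime_mult_left_iff)
  have "cnj (chi b) = chi b'" if "dirichlet_character f chi" for chi
  proof -
    have "chi b * chi b' = 1"
      using dirichlet_character_cong[OF that b'] dirichlet_character_mult[OF that]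
        dirichlet_character_1[OF that] by simp
    moreover have "cnj (chi b) * chi b = 1"
      using True by (intro dirichlet_character_cnj_mult[OF f that]) simp
    ultimately show ?thesis by (metis mult.assoc mult_1 mult_1_right)
  qed
  then have eq: "(\<Sum>chi | dirichlet_character f chi. chi a * cnj (chi b)) =
      (\<Sum>chi | dirichlet_character f chi. chi (a * b'))"
    by (intro sum.cong) (auto simp: dirichlet_character_mult)
  have iff: "[a * b' = 1] (mod int f) \<longleftrightarrow> [a = b] (mod int f)"
    using b' \<open>coprime b' (int f)\<close> by (metis cong_mult_rcancel cong_sym cong_trans)
  show ?thesis
  proof (cases "[a = b] (mod int f)")
    case False
    then show ?thesis
      using eq iff True \<open>coprime b' (int f)\<close> sum_over_dirichlet_characters[OF f, of "a * b'"] by simp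
  next
    case eq': True
    then have "chi (a * b') = 1" if "dirichlet_character f chi" for chi
      using iff dirichlet_character_cong[OF that, of "a * b'" 1] dirichlet_character_1[OF that] by simp
    then have "(\<Sum>chi | dirichlet_character f chi. chi (a * b')) = (\<Sum>chi | dirichlet_character f chi. 1)"
      by (intro sum.cong) auto
    then show ?thesis using eq eq' True by (simp add: card_dirichlet_characters[OF assms])
  qed
next
  case False
  then have "\<not> (coprime a (int f) \<and> [a = b] (mod int f))"
    using cong_imp_coprime by blast
  moreover have "(\<Sum>chi | dirichlet_character f chi. chi a * cnj (chi b)) = 0"
    using False by (intro sum.neutral) (auto simp: dirichlet_character_eq_0_iff)
  ultimately show ?thesis by auto
qed

section \<open>The second moment\<close>

text \<open>The discrete Fourier transform of \<open>chi\<close> modulo f, a Gauss sum with shift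
  k.\<close>

definition char_transform :: "nat \<Rightarrow> (int \<Rightarrow> complex) \<Rightarrow> int \<Rightarrow> complex" where
  "char_transform f chi k = (\<Sum>a\<in>{0..<int f}. chi a * add_char f (- (a * k)))"

text \<open>Equals \<open>L(1, chi)\<close> for even non-trivial \<open>chi\<close> and vanishes for odd \<open>chi\<close>, but it also makes sense
  for the trivial character, so that it can be summed over the full character group.\<close>

definition log_sine_sum :: "nat \<Rightarrow> (int \<Rightarrow> complex) \<Rightarrow> complex" where
  "log_sine_sum f chi = - (\<Sum>k\<in>{0..<int f}. char_transform f chi k * of_real (log_sine f k)) / of_nat f"

lemma char_transform_cong:
  assumes "f > 0" "[k = l] (mod int f)"
  shows "char_transform f chi k = char_transform f chi l"
  unfolding char_transform_def using assms
  by (intro sum.cong refl arg_cong2[of _ _ _ _ "(*)"] add_char_cong)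
     (auto simp: cong_minus_minus_iff cong_scalar_left)

lemma char_transform_minus:
  assumes "f > 0" "dirichlet_character f chi"
  shows "char_transform f chi (- k) = chi (- 1) * char_transform f chi k"
proof -
  have "char_transform f chi (- k) = (\<Sum>a\<in>{0..<int f}. chi (- 1 * a) * add_char f (- ((- 1 * a) * - k)))"
    unfolding char_transform_def
  proof (rule sum_residues_mult[symmetric, OF assms(1)])
    show "chi m * add_char f (- (m * - k)) = chi n * add_char f (- (n * - k))"
      if "[m = n] (mod int f)" for m n
      using that assms dirichlet_character_cong[OF assms(2) that]
      by (auto intro!: add_char_cong cong_scalar_right)
  qed simp
  also have "\<dots> = chi (- 1) * char_transform f chi k"
    unfolding char_transform_def sum_distrib_left dirichlet_character_mult[OF assms(2)]
    by (simp add: mult.assoc)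
  finally show ?thesis .
qed

lemma char_transform_inversion:
  assumes "f > 0" "dirichlet_character f chi"
  shows "(\<Sum>k\<in>{0..<int f}. char_transform f chi k * add_char f (k * n)) = of_nat f * chi n"
proof -
  have "(\<Sum>k\<in>{0..<int f}. char_transform f chi k * add_char f (k * n)) =
          (\<Sum>k\<in>{0..<int f}. \<Sum>a\<in>{0..<int f}. chi a * add_char f (k * (n - a)))"
    unfolding char_transform_def sum_distrib_right
    by (intro sum.cong refl) (simp add: mult.assoc algebra_simps flip: add_char_add)
  also have "\<dots> = (\<Sum>a\<in>{0..<int f}. chi a * (\<Sum>k\<in>{0..<int f}. add_char f (k * (n - a))))"
    by (subst sum.swap) (simp add: sum_distrib_left)
  also have "\<dots> = (\<Sum>a\<in>{0..<int f}. if a = n mod int f then chi a * of_nat f else 0)"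
  proof (intro sum.cong refl)
    fix a assume a: "a \<in> {0..<int f}"
    have "int f dvd n - a \<longleftrightarrow> a = n mod int f"
      using a by (auto simp: mod_eq_dvd_iff[symmetric])
    then show "chi a * (\<Sum>k\<in>{0..<int f}. add_char f (k * (n - a))) =
        (if a = n mod int f then chi a * of_nat f else 0)"
      by (simp add: sum_add_char[OF assms(1)])
  qed
  also have "\<dots> = chi (n mod int f) * of_nat f"
    using assms(1) by (simp add: sum.delta')
  also have "chi (n mod int f) = chi n"
    by (intro dirichlet_character_cong[OF assms(2)]) simp
  finally show ?thesis by (simp add: mult.commute)
qed

text \<open>Replacing k by -k preserves the log-sines and multiplies the transform by chi(-1), so
  the sum equals chi(-1) times itself.\<close>

lemma log_sine_sum_odd:
  assumes "f > 0" "dirichlet_character f chi" "chi (- 1) \<noteq> 1"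
  shows "log_sine_sum f chi = 0"
proof -
  let ?h = "\<lambda>k. char_transform f chi k * of_real (log_sine f k)"
  have "(\<Sum>k\<in>{0..<int f}. ?h (- 1 * k)) = (\<Sum>k\<in>{0..<int f}. ?h k)"
    using assms(1) char_transform_cong[OF assms(1)] log_sine_cong[OF assms(1)]
    by (intro sum_residues_mult) auto
  then have "(chi (- 1) - 1) * (\<Sum>k\<in>{0..<int f}. ?h k) = 0"
    by (simp add: char_transform_minus[OF assms(1,2)] log_sine_minus left_diff_distrib mult.assoc
        flip: sum_distrib_left)
  with assms(3) show ?thesis by (simp add: log_sine_sum_def)
qed

lemma dirichlet_L_1_even:
  assumes "f > 0" "dirichlet_character f chi" "chi \<noteq> trivial_character f" "chi (- 1) = 1"
  shows "dirichlet_L 1 chi = log_sine_sum f chi"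
proof -
  let ?C = "char_transform f chi" and ?e = "add_char f"
  let ?h = "\<lambda>k. ?C k * - Ln (1 - ?e k)"
  \<comment> \<open>At k = 0 the series is harmonic and diverges; a non-trivial character has
    coefficient 0 there.\<close>
  have C0: "?C k = 0" if "?e k = 1" for k
  proof -
    have "?C k = ?C 0"
      using that assms(1) by (intro char_transform_cong) (auto simp: add_char_eq_1_iff cong_0_iff)
    also have "\<dots> = 0"
      using sum_dirichlet_character[OF assms(1-3)] by (simp add: char_transform_def)
    finally show ?thesis .
  qed
  have "(\<lambda>n. \<Sum>k\<in>{0..<int f}. ?C k * (?e k ^ Suc n / of_nat (Suc n))) sums (\<Sum>k\<in>{0..<int f}. ?h k)"
  proof (intro sums_sum)
    fix k
    show "(\<lambda>n. ?C k * (?e k ^ Suc n / of_nat (Suc n))) sums ?h k"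
    proof (cases "?e k = 1")
      case True
      then show ?thesis by (simp add: C0)
    next
      case False
      then show ?thesis by (intro sums_mult sums_Ln_unit_circle) simp_all
    qed
  qed
  moreover have "(\<Sum>k\<in>{0..<int f}. ?C k * (?e k ^ Suc n / of_nat (Suc n))) =
      of_nat f * (chi (int (Suc n)) / of_nat (Suc n) powr 1)" for n
  proof -
    have "(\<Sum>k\<in>{0..<int f}. ?C k * (?e k ^ Suc n / of_nat (Suc n))) =
        (\<Sum>k\<in>{0..<int f}. ?C k * ?e (k * int (Suc n))) / of_nat (Suc n)"
      unfolding sum_divide_distrib add_char_power
      by (intro sum.cong refl) (simp only: times_divide_eq_right mult.commute[of "int (Suc n)"])
    also have "\<dots> = of_nat f * (chi (int (Suc n)) / of_nat (Suc n) powr 1)"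
      unfolding char_transform_inversion[OF assms(1,2)] by (simp del: of_nat_Suc)
    finally show ?thesis .
  qed
  ultimately have "(\<lambda>n. of_nat f * (chi (int (Suc n)) / of_nat (Suc n) powr 1)) sums (\<Sum>k\<in>{0..<int f}. ?h k)"
    by simp
  then have "(\<lambda>n. chi (int (Suc n)) / of_nat (Suc n) powr 1) sums ((\<Sum>k\<in>{0..<int f}. ?h k) / of_nat f)"
    using assms(1) sums_divide[of _ _ "of_nat f"] by fastforce
  then have L: "dirichlet_L 1 chi = (\<Sum>k\<in>{0..<int f}. ?h k) / of_nat f"
    unfolding dirichlet_L_def by (rule sums_unique[symmetric])
  \<comment> \<open>Averaging over k and -k, whose coefficients agree for even \<open>chi\<close>,
    replaces the complex logarithms by real log-sines.\<close>
  have "(\<Sum>k\<in>{0..<int f}. ?h (- 1 * k)) = (\<Sum>k\<in>{0..<int f}. ?h k)"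
  proof (rule sum_residues_mult[OF assms(1)])
    show "?h k = ?h l" if "[k = l] (mod int f)" for k l
      using char_transform_cong[OF assms(1) that] add_char_cong[OF assms(1) that] by simp
  qed simp
  then have "2 * (\<Sum>k\<in>{0..<int f}. ?h k) = (\<Sum>k\<in>{0..<int f}. ?h k + ?h (- 1 * k))"
    by (simp only: sum.distrib mult_2)
  also have "\<dots> = (\<Sum>k\<in>{0..<int f}. - 2 * (?C k * of_real (log_sine f k)))"
  proof (intro sum.cong refl)
    fix k
    show "?h k + ?h (- 1 * k) = - 2 * (?C k * of_real (log_sine f k))"
    proof (cases "?e k = 1")
      case True
      then show ?thesis by (simp add: C0 char_transform_minus[OF assms(1,2)])
    next
      case False
      have "?h k + ?h (- 1 * k) = - ?C k * (Ln (1 - ?e k) + Ln (cnj (1 - ?e k)))"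
        by (simp add: char_transform_minus[OF assms(1,2)] assms(4) add_char_minus algebra_simps)
      also have "Ln (1 - ?e k) + Ln (cnj (1 - ?e k)) = of_real (2 * log_sine f k)"
        using Re_less_1_unit_circle[of "?e k"] False by (subst Ln_add_Ln_cnj) (simp_all add: log_sine_eq)
      finally show ?thesis by simp
    qed
  qed
  also have "\<dots> = 2 * - (\<Sum>k\<in>{0..<int f}. ?C k * of_real (log_sine f k))"
    by (simp add: sum_negf flip: sum_distrib_left)
  finally show ?thesis
    by (simp add: L log_sine_sum_def)
qed

text \<open>The transform of the trivial character is a Ramanujan sum. The log-sines over the
  multiples of d add up to log (f / d), and exchanging d with f / d leads to f times the sum of
  mu(d) log d / d.\<close>

lemma log_sine_sum_trivial:
  assumes "f > 0"
  shows "log_sine_sum f (trivial_character f) =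
    of_real (real (totient f) / real f * (\<Sum>p | prime p \<and> p dvd f. ln (real p) / (real p - 1)))"
proof -
  let ?\<Lambda> = "log_sine f"
  let ?m = "\<lambda>d. real_of_int (moebius_mu (f div d)) * real d"
  have C: "char_transform f (trivial_character f) k =
      of_real (\<Sum>d | d dvd f. ?m d * (if int d dvd k then 1 else 0))" for k
  proof -
    have "char_transform f (trivial_character f) k =
        (\<Sum>a | a \<in> {0..<int f} \<and> coprime a (int f). add_char f (a * - k))"
      unfolding char_transform_def
      by (rule sum.mono_neutral_cong_right) (auto simp: trivial_character_def)
    also have "\<dots> = of_real (\<Sum>d | d dvd f. ?m d * (if int d dvd k then 1 else 0))"
      unfolding ramanujan_sum[OF assms] of_real_sum by (intro sum.cong refl) auto
    finally show ?thesis .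
  qed
  have "(\<Sum>k\<in>{0..<int f}. (\<Sum>d | d dvd f. ?m d * (if int d dvd k then 1 else 0)) * ?\<Lambda> k) =
      (\<Sum>k\<in>{0..<int f}. \<Sum>d | d dvd f. if int d dvd k then ?m d * ?\<Lambda> k else 0)"
    unfolding sum_distrib_right by (intro sum.cong refl) auto
  also have "\<dots> = (\<Sum>d | d dvd f. \<Sum>k\<in>{0..<int f}. if int d dvd k then ?m d * ?\<Lambda> k else 0)"
    by (rule sum.swap)
  also have "\<dots> = (\<Sum>d | d dvd f. ?m d * (\<Sum>k | k \<in> {0..<int f} \<and> [k = 0] (mod int d). ?\<Lambda> k))"
    unfolding sum_distrib_left
    by (intro sum.cong refl sum.mono_neutral_cong_right) (auto simp: cong_0_iff)
  also have "\<dots> = (\<Sum>d | d dvd f. ?m d * ln (real f / real d))"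
  proof (intro sum.cong refl)
    fix d assume "d \<in> {d. d dvd f}"
    then show "?m d * (\<Sum>k | k \<in> {0..<int f} \<and> [k = 0] (mod int d). ?\<Lambda> k) = ?m d * ln (real f / real d)"
      using sum_log_sine_residue_class[OF assms, of d 0] by (simp add: log_sine_def[of d])
  qed
  also have "\<dots> = (\<Sum>d | d dvd f. real_of_int (moebius_mu d) * real (f div d) * ln (real f / real (f div d)))"
    by (rule sum_divisors_flip[OF assms, symmetric, of
        "\<lambda>d e. real_of_int (moebius_mu d) * real e * ln (real f / real e)"])
  also have "\<dots> = real f * (\<Sum>d | d dvd f. of_int (moebius_mu d) * (ln (real d) / real d))"
    unfolding sum_distrib_left using assms by (intro sum.cong refl) (auto simp: real_of_nat_div)
  finally have "(\<Sum>k\<in>{0..<int f}. (\<Sum>d | d dvd f. ?m d * (if int d dvd k then 1 else 0)) * ?\<Lambda> k) =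
      - real f * (real (totient f) / real f * (\<Sum>p | prime p \<and> p dvd f. ln (real p) / (real p - 1)))"
    unfolding sum_moebius_mu_ln[OF assms] by simp
  then have "- (\<Sum>k\<in>{0..<int f}. (\<Sum>d | d dvd f. ?m d * (if int d dvd k then 1 else 0)) * ?\<Lambda> k) / real f =
      real (totient f) / real f * (\<Sum>p | prime p \<and> p dvd f. ln (real p) / (real p - 1))"
    using assms by simp
  from arg_cong[OF this, of complex_of_real] show ?thesis
    by (simp only: log_sine_sum_def C of_real_mult of_real_sum of_real_minus of_real_divide of_real_of_nat_eq)
qed

text \<open>The congruence sees l only through its class r modulo d, so the double sum becomes the
  sum of A(c r) A(r), with A the class sums. Since c is a unit modulo d, c r is zero exactly when r
  is: r = 0 gives the squared logarithm, the other classes give R(c, d).\<close>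

lemma sum_log_sine_congruent_pairs:
  assumes "f > 0" "coprime c f" "d dvd f"
  shows "(\<Sum>l\<in>{0..<int f}. \<Sum>k | k \<in> {0..<int f} \<and> [k = int c * l] (mod int d). log_sine f k * log_sine f l) =
           (ln (real f / real d))\<^sup>2 + R_sum c d"
proof -
  have d: "d > 0" using assms by (auto intro: dvd_pos_nat)
  have cd: "coprime (int c) (int d)"
    using assms(2,3) coprime_divisors[of c c d f] by simp
  define A where "A n = log_sine d n + (if int d dvd n then ln (real f / real d) else 0)" for n
  have A_cong: "A m = A n" if "[m = n] (mod int d)" for m n
    using that log_sine_cong[OF d that] cong_dvd_iff[OF that] by (simp add: A_def cong_dvd_modulus)
  have A: "(\<Sum>k | k \<in> {0..<int f} \<and> [k = n] (mod int d). log_sine f k) = A n" for n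
    unfolding A_def using assms(1,3) by (rule sum_log_sine_residue_class)
  have "(\<Sum>l\<in>{0..<int f}. \<Sum>k | k \<in> {0..<int f} \<and> [k = int c * l] (mod int d). log_sine f k * log_sine f l) =
      (\<Sum>l\<in>{0..<int f}. A (int c * l) * log_sine f l)"
    by (simp only: sum_distrib_right[symmetric] A)
  also have "\<dots> = (\<Sum>r\<in>{0..<int d}. \<Sum>l | l \<in> {0..<int f} \<and> l mod int d = r. A (int c * l) * log_sine f l)"
    using d by (intro sum.group[symmetric]) auto
  also have "\<dots> = (\<Sum>r\<in>{0..<int d}. A (int c * r) * A r)"
  proof (intro sum.cong refl)
    fix r assume r: "r \<in> {0..<int d}"
    have "(\<Sum>l | l \<in> {0..<int f} \<and> l mod int d = r. A (int c * l) * log_sine f l) =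
        (\<Sum>l | l \<in> {0..<int f} \<and> [l = r] (mod int d). A (int c * r) * log_sine f l)"
      using r by (intro sum.cong) (auto simp: cong_def intro!: A_cong[unfolded cong_def] mod_mult_cong)
    then show "(\<Sum>l | l \<in> {0..<int f} \<and> l mod int d = r. A (int c * l) * log_sine f l) = A (int c * r) * A r"
      by (simp only: sum_distrib_left[symmetric] A)
  qed
  also have "\<dots> = A (int c * 0) * A 0 + (\<Sum>r\<in>{0..<int d} - {0}. A (int c * r) * A r)"
    using d by (intro sum.remove) auto
  also have "A (int c * 0) * A 0 = (ln (real f / real d))\<^sup>2"
    by (simp add: A_def log_sine_def power2_eq_square)
  also have "(\<Sum>r\<in>{0..<int d} - {0}. A (int c * r) * A r) = R_sum c d"
    unfolding R_sum_def
  proof (rule sum.reindex_bij_witness[of _ int nat])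
    fix r assume r: "r \<in> {0..<int d} - {0}"
    then have "\<not> int d dvd r" by (auto dest: zdvd_imp_le)
    moreover from this have "\<not> int d dvd int c * r"
      using cd by (simp add: coprime_dvd_mult_right_iff coprime_commute)
    ultimately show "ln \<bar>2 * sin (pi * real (nat r) / real d)\<bar> *
        ln \<bar>2 * sin (pi * real c * real (nat r) / real d)\<bar> = A (int c * r) * A r"
      using r by (simp add: A_def log_sine_def mult_ac)
  qed auto
  finally show ?thesis .
qed

lemma log_sine_sum_second_moment:
  assumes "f > 1" "coprime c f"
  shows "(\<Sum>chi | dirichlet_character f chi. chi (int c) * of_real ((cmod (log_sine_sum f chi))\<^sup>2)) =
     of_real (real (totient f) / (real f)\<^sup>2 *
       (\<Sum>d | d dvd f. real_of_int (moebius_mu (f div d)) * real d *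
          ((ln (real f / real d))\<^sup>2 + R_sum c d)))"
proof -
  have f: "f > 0" using assms by simp
  let ?Z = "{0..<int f}" and ?\<Lambda> = "\<lambda>k. complex_of_real (log_sine f k)"
  let ?X = "{chi. dirichlet_character f chi}" and ?U = "{a. a \<in> {0..<int f} \<and> coprime a (int f)}"
  let ?m = "\<lambda>d. real_of_int (moebius_mu (f div d)) * real d"
  have cf: "coprime (int c) (int f)" using assms(2) by simp
  \<comment> \<open>The Fourier transform is moved from \<open>chi\<close> to the log-sines, so that
    characters occur only through their values and orthogonality applies.\<close>
  define G where "G a = (\<Sum>k\<in>?Z. ?\<Lambda> k * add_char f (- (a * k)))" for a
  have G_cong: "G a = G b" if "[a = b] (mod int f)" for a b
    unfolding G_def using that f
    by (intro sum.cong refl arg_cong2[of _ _ _ _ "(*)"] add_char_cong)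
       (auto simp: cong_minus_minus_iff cong_scalar_right)
  have S: "log_sine_sum f chi = - (\<Sum>a\<in>?Z. chi a * G a) / of_nat f" for chi
  proof -
    have "(\<Sum>k\<in>?Z. char_transform f chi k * ?\<Lambda> k) = (\<Sum>k\<in>?Z. \<Sum>a\<in>?Z. chi a * (?\<Lambda> k * add_char f (- (a * k))))"
      unfolding char_transform_def sum_distrib_right by (intro sum.cong refl) (simp add: mult_ac)
    also have "\<dots> = (\<Sum>a\<in>?Z. chi a * G a)"
      unfolding G_def sum_distrib_left by (rule sum.swap)
    finally show ?thesis by (simp add: log_sine_sum_def)
  qed
  have "(of_nat f)\<^sup>2 * (\<Sum>chi\<in>?X. chi (int c) * of_real ((cmod (log_sine_sum f chi))\<^sup>2)) =
      (\<Sum>chi\<in>?X. \<Sum>a\<in>?Z. \<Sum>b\<in>?Z. (G a * cnj (G b)) * (chi (int c * a) * cnj (chi b)))"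
    unfolding sum_distrib_left
  proof (intro sum.cong refl)
    fix chi assume "chi \<in> ?X"
    then have chi: "chi (int c * a) = chi (int c) * chi a" for a
      by (simp add: dirichlet_character_mult)
    have "(of_nat f)\<^sup>2 * (chi (int c) * of_real ((cmod (log_sine_sum f chi))\<^sup>2)) =
        chi (int c) * ((\<Sum>a\<in>?Z. chi a * G a) * cnj (\<Sum>b\<in>?Z. chi b * G b))"
      unfolding complex_norm_square S using f by (simp add: power2_eq_square)
    also have "\<dots> = (\<Sum>a\<in>?Z. \<Sum>b\<in>?Z. (G a * cnj (G b)) * (chi (int c * a) * cnj (chi b)))"
      unfolding cnj_sum sum_product unfolding sum_distrib_left chi
      by (intro sum.cong refl) (simp add: mult_ac)
    finally show "(of_nat f)\<^sup>2 * (chi (int c) * of_real ((cmod (log_sine_sum f chi))\<^sup>2)) = \<dots>" .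
  qed
  also have "\<dots> = (\<Sum>a\<in>?Z. \<Sum>b\<in>?Z. G a * cnj (G b) * (\<Sum>chi\<in>?X. chi (int c * a) * cnj (chi b)))"
    unfolding sum_distrib_left by (rule trans[OF sum.swap], rule sum.cong[OF refl], rule sum.swap)
  \<comment> \<open>Orthogonality leaves only b congruent to c a, with a coprime to f.\<close>
  also have "\<dots> = (\<Sum>a\<in>?Z. if coprime a (int f) then of_nat (totient f) * (G a * cnj (G (int c * a))) else 0)"
  proof (intro sum.cong refl)
    fix a assume "a \<in> ?Z"
    have "(\<Sum>b\<in>?Z. G a * cnj (G b) * (\<Sum>chi\<in>?X. chi (int c * a) * cnj (chi b))) =
        (\<Sum>b\<in>?Z. if b = int c * a mod int f then
           (if coprime a (int f) then of_nat (totient f) * (G a * cnj (G b)) else 0) else 0)"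
      unfolding dirichlet_characters_orthogonal[OF assms(1)]
      by (intro sum.cong refl) (use cf in \<open>auto simp: cong_def\<close>)
    also have "\<dots> = (if coprime a (int f) then of_nat (totient f) * (G a * cnj (G (int c * a mod int f))) else 0)"
      using f by (simp add: sum.delta')
    also have "G (int c * a mod int f) = G (int c * a)"
      by (intro G_cong) simp
    finally show "(\<Sum>b\<in>?Z. G a * cnj (G b) * (\<Sum>chi\<in>?X. chi (int c * a) * cnj (chi b))) =
        (if coprime a (int f) then of_nat (totient f) * (G a * cnj (G (int c * a))) else 0)" .
  qed
  also have "\<dots> = of_nat (totient f) * (\<Sum>a\<in>?U. G a * cnj (G (int c * a)))"
    unfolding sum_distrib_left by (rule sum.mono_neutral_cong_right) auto
  \<comment> \<open>Conjugation reverses the sign of the phase of l, so the phases combine to a (c l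
    - k), and the sum over units a is a Ramanujan sum.\<close>
  also have "(\<Sum>a\<in>?U. G a * cnj (G (int c * a))) =
      (\<Sum>a\<in>?U. \<Sum>l\<in>?Z. \<Sum>k\<in>?Z. ?\<Lambda> k * ?\<Lambda> l * add_char f (a * (int c * l - k)))"
  proof (intro sum.cong refl)
    fix a
    have "G a * cnj (G (int c * a)) =
        (\<Sum>k\<in>?Z. \<Sum>l\<in>?Z. (?\<Lambda> k * add_char f (- (a * k))) * cnj (?\<Lambda> l * add_char f (- (int c * a * l))))"
      unfolding G_def cnj_sum sum_product ..
    also have "\<dots> = (\<Sum>k\<in>?Z. \<Sum>l\<in>?Z. ?\<Lambda> k * ?\<Lambda> l * add_char f (a * (int c * l - k)))"
    proof (intro sum.cong refl)
      fix k l
      have "add_char f (a * (int c * l - k)) = add_char f (- (a * k)) * add_char f (int c * a * l)"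
        by (simp add: algebra_simps flip: add_char_add)
      then show "(?\<Lambda> k * add_char f (- (a * k))) * cnj (?\<Lambda> l * add_char f (- (int c * a * l))) =
          ?\<Lambda> k * ?\<Lambda> l * add_char f (a * (int c * l - k))"
        by (simp add: add_char_minus)
    qed
    also have "\<dots> = (\<Sum>l\<in>?Z. \<Sum>k\<in>?Z. ?\<Lambda> k * ?\<Lambda> l * add_char f (a * (int c * l - k)))"
      by (rule sum.swap)
    finally show "G a * cnj (G (int c * a)) = \<dots>" .
  qed
  also have "\<dots> = (\<Sum>l\<in>?Z. \<Sum>k\<in>?Z. ?\<Lambda> k * ?\<Lambda> l * (\<Sum>a\<in>?U. add_char f (a * (int c * l - k))))"
    unfolding sum_distrib_left by (rule trans[OF sum.swap], rule sum.cong[OF refl], rule sum.swap)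
  also have "\<dots> = (\<Sum>l\<in>?Z. \<Sum>k\<in>?Z. \<Sum>d | d dvd f.
      of_real (?m d * (if [k = int c * l] (mod int d) then log_sine f k * log_sine f l else 0)))"
    unfolding ramanujan_sum[OF f] sum_distrib_left
    by (intro sum.cong refl) (auto simp: cong_iff_dvd_diff dvd_diff_commute)
  also have "\<dots> = of_real (\<Sum>l\<in>?Z. \<Sum>k\<in>?Z. \<Sum>d | d dvd f.
      ?m d * (if [k = int c * l] (mod int d) then log_sine f k * log_sine f l else 0))"
    by (simp only: of_real_sum)
  also have "(\<Sum>l\<in>?Z. \<Sum>k\<in>?Z. \<Sum>d | d dvd f.
      ?m d * (if [k = int c * l] (mod int d) then log_sine f k * log_sine f l else 0)) =
      (\<Sum>l\<in>?Z. \<Sum>d | d dvd f. \<Sum>k\<in>?Z.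
      ?m d * (if [k = int c * l] (mod int d) then log_sine f k * log_sine f l else 0))"
    by (intro sum.cong refl, rule sum.swap)
  also have "\<dots> = (\<Sum>d | d dvd f. \<Sum>l\<in>?Z. \<Sum>k\<in>?Z.
      ?m d * (if [k = int c * l] (mod int d) then log_sine f k * log_sine f l else 0))"
    by (rule sum.swap)
  also have "\<dots> = (\<Sum>d | d dvd f. ?m d * ((ln (real f / real d))\<^sup>2 + R_sum c d))"
  proof (intro sum.cong refl)
    fix d assume "d \<in> {d. d dvd f}"
    then have *: "d dvd f" by simp
    have "(\<Sum>k\<in>?Z. if [k = int c * l] (mod int d) then log_sine f k * log_sine f l else 0) =
        (\<Sum>k | k \<in> ?Z \<and> [k = int c * l] (mod int d). log_sine f k * log_sine f l)" for l
      by (rule sum.mono_neutral_cong_right) auto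
    then show "(\<Sum>l\<in>?Z. \<Sum>k\<in>?Z.
      ?m d * (if [k = int c * l] (mod int d) then log_sine f k * log_sine f l else 0)) =
      ?m d * ((ln (real f / real d))\<^sup>2 + R_sum c d)"
      by (simp only: sum_distrib_left[symmetric] sum_log_sine_congruent_pairs[OF f assms(2) *])
  qed
  finally have "(of_nat f)\<^sup>2 * (\<Sum>chi\<in>?X. chi (int c) * of_real ((cmod (log_sine_sum f chi))\<^sup>2)) =
      of_nat (totient f) * of_real (\<Sum>d | d dvd f. ?m d * ((ln (real f / real d))\<^sup>2 + R_sum c d))" .
  then show ?thesis
    using f by (simp add: field_simps)
qed

theorem theorem1p2:
  fixes f c :: nat
  assumes "c > 1" and "f > c" and "gcd f c = 1"
  shows "M_plus f c = complex_of_real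
    (real (totient f) / (real f)\<^sup>2 *
       (\<Sum>d | d dvd f. real_of_int (moebius_mu (f div d)) * real d *
          ((ln (real f / real d))\<^sup>2 + R_sum c d))
     - (real (totient f) / real f *
          (\<Sum>p | prime p \<and> p dvd f. ln (real p) / (real p - 1)))\<^sup>2)"
proof -
  let ?X = "{chi. dirichlet_character f chi}" and ?t = "trivial_character f"
  let ?g = "\<lambda>chi. chi (int c) * complex_of_real ((cmod (log_sine_sum f chi))\<^sup>2)"
  let ?B = "real (totient f) / real f * (\<Sum>p | prime p \<and> p dvd f. ln (real p) / (real p - 1))"
  have f: "f > 0" "f > 1" using assms by auto
  have cf: "coprime c f" using assms(3) by (metis coprime_iff_gcd_eq_1 gcd.commute)
  \<comment> \<open>The odd characters are put back as zero terms, so only the trivial character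
    separates this from the full group.\<close>
  have "M_plus f c = (\<Sum>chi\<in>?X - {?t}. ?g chi)"
    unfolding M_plus_def
  proof (rule sum.mono_neutral_cong_left)
    show "finite (?X - {?t})" using finite_dirichlet_characters[OF f(1)] by simp
  qed (auto simp: dirichlet_L_1_even[OF f(1)] log_sine_sum_odd[OF f(1)])
  moreover have "(\<Sum>chi\<in>?X. ?g chi) = ?g ?t + (\<Sum>chi\<in>?X - {?t}. ?g chi)"
    using finite_dirichlet_characters[OF f(1)] dirichlet_character_trivial by (intro sum.remove) auto
  \<comment> \<open>The weight of the trivial character is 1, as c is coprime to f.\<close>
  moreover have "?g ?t = of_real (?B\<^sup>2)"
    using cf unfolding log_sine_sum_trivial[OF f(1)] norm_of_real power2_abs
    by (simp add: trivial_character_def)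
  ultimately have "M_plus f c = (\<Sum>chi\<in>?X. ?g chi) - of_real (?B\<^sup>2)"
    by simp
  then show ?thesis
    unfolding log_sine_sum_second_moment[OF f(2) cf] by (simp only: of_real_diff)
qed

end
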